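(* Every $3$-edge-coloured graph $G$ can be covered by $2\alpha(G)$ monochromatic components of diameter at most $9^{3^{2^{\alpha(G)^{12}}}}$.
   Context: Graphs are finite. A $3$-edge-coloured graph is a graph each of whose edges is assigned one of $3$ colours. $\alpha(G)$ denotes the independence number of $G$, i.e. the size of a maximum set of vertices containing no edges. A monochromatic component means a connected subgraph (a single vertex is allowed) all of whose edges have the same colour; it is not required to be a maximal such subgraph. Its diameter is the maximum, over pairs of its vertices, of their distance inside that subgraph. $G$ is covered by $N$ monochromatic components if there is a collection of at most $N$ of them (not necessarily disjoint) whose vertex sets have union $V(G)$. Exponent towers are read as $a^{b^{c}}=a^{(b^{c})}$. *)

theory Defs
  imports "Graph_Theory.Graph_Theory"
begin

text \<open>
  Finite simple graphs are the \<^locale>\<open>pair_graph\<close>s: finite vertex set, and an irreflexive,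
  symmetric arc set, so that an undirected edge \<open>uv\<close> is the pair of arcs \<open>(u, v)\<close>, \<open>(v, u)\<close>.
\<close>

text \<open>
  A colouring is a function on unordered pairs, so both arcs of an edge have the same colour;
  its values off the edges of the graph are irrelevant.
\<close>

definition edge_coloured :: "nat \<Rightarrow> 'a pair_pre_digraph \<Rightarrow> ('a set \<Rightarrow> nat) \<Rightarrow> bool" where
  "edge_coloured k G c \<longleftrightarrow> pair_graph G \<and> (\<forall>(u, v) \<in> parcs G. c {u, v} < k)"

definition independent :: "'a pair_pre_digraph \<Rightarrow> 'a set \<Rightarrow> bool" where
  "independent G S \<longleftrightarrow> S \<subseteq> pverts G \<and> (\<forall>u \<in> S. \<forall>v \<in> S. (u, v) \<notin> parcs G)"

definition independence_number :: "'a pair_pre_digraph \<Rightarrow> nat" where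
  "independence_number G = Max (card ` {S. independent G S})"

text \<open>
  \<open>H\<close> is neither required to be induced nor maximal. The library's \<open>connected\<close> excludes
  the null graph and allows a single vertex.
\<close>

definition monochromatic_component ::
    "'a pair_pre_digraph \<Rightarrow> ('a set \<Rightarrow> nat) \<Rightarrow> 'a pair_pre_digraph \<Rightarrow> bool" where
  "monochromatic_component G c H \<longleftrightarrow>
     pair_graph H \<and> subgraph (with_proj H) (with_proj G) \<and>
     Digraph_Component.connected (with_proj H) \<and>
     (\<exists>i. \<forall>(u, v) \<in> parcs H. c {u, v} = i)"

text \<open>
  Distance is the library's infimum \<open>\<mu>\<close> of walk costs, taken with unit arc costs, i.e. of
  walk lengths; it is \<open>\<infinity>\<close> if there is no walk.
\<close>

definition distance :: "'a pair_pre_digraph \<Rightarrow> 'a \<Rightarrow> 'a \<Rightarrow> ereal" where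
  "distance H u v = wf_digraph.\<mu> (with_proj H) (\<lambda>_. 1) u v"

definition diameter :: "'a pair_pre_digraph \<Rightarrow> ereal" where
  "diameter H = Max {distance H u v | u v. u \<in> pverts H \<and> v \<in> pverts H}"

end

theory Submission
  imports Defs "HOL-Library.Z2"
begin

text \<open>
  The proof combines a sharp covering theorem without control on the diameter with a branching
  argument that adds such control at no cost in the number of components.

  The covering theorem states that a graph with three colours is covered by \<open>2 * \<alpha>\<close> monochromatic
  components (\<open>component_cover\<close>). Regard each vertex as a hyperedge joining the three monochromatic
  components that contain it. This gives a tripartite 3-uniform hypergraph. Its matchings are
  independent sets of vertices and its covers are sets of components that cover the graph. So
  what is needed is Aharoni's theorem that the cover number of a tripartite 3-uniform hypergraph
  is at most twice its matching number (\<open>tripartite_cover\<close>).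

  Aharoni's theorem follows from a topological version of Hall's theorem (\<open>hall_transversal\<close>). Let
  the vertices of a graph be labelled, and suppose that for each nonempty set \<open>I\<close> of labels the
  vertices labelled in \<open>I\<close> contain an independent set that is not dominated by fewer than \<open>card I\<close>
  of these vertices. Then there is an independent set with exactly one vertex of each label. The
  domination condition makes the independence complex acyclic in low dimensions
  (\<open>null_homotopy\<close>, \<open>fill_cycle\<close>). Hence the simplex on the label set maps to the independence
  complex in a way that respects labels (\<open>exists_filling_system\<close>), and a parity count as in
  Sperner's lemma (\<open>sum_boundary_transversals\<close>) finds the transversal. All homology is taken modulo
  2 and is reduced to manipulating sums in the field with two elements. Koenig's theorem, the
  other ingredient of Aharoni's theorem, is a further instance of the same Hall theorem.

  For the diameter, suppose that no \<open>2 * \<alpha>\<close> monochromatic balls of radius \<open>r\<close> cover the graph. A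
  branching argument (\<open>balls_or_obstruction\<close>) finds a set \<open>S\<close> of at most \<open>1 + 3 + \<dots> + 3 ^ (2 * \<alpha>)\<close>
  vertices that witnesses this failure: \<open>S\<close> is not even covered by \<open>2 * \<alpha>\<close> sets each of which lies,
  for some colour, in the ball of radius \<open>r\<close> around each of its points. But the covering theorem,
  applied to the graph induced on \<open>S\<close>, provides such sets as soon as \<open>r\<close> is at least the square of
  the size of \<open>S\<close>, because a component on few vertices has small diameter (\<open>ball_cover\<close>). Balls of
  radius \<open>r\<close> have diameter at most \<open>2 * r\<close>, and the resulting bound \<open>9 ^ (2 * \<alpha> + 1)\<close> lies below the
  required one.
\<close>

section \<open>Chains modulo 2\<close>

lemma bit_double [simp]: "x + x = (0::bit)"
  by (cases x) simp_all

lemma bit_add_eq_0_iff: "x + y = 0 \<longleftrightarrow> x = y" for x y :: bit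
  by (cases x; cases y) simp_all

(* These rules turn sums and products of bits into Boolean connectives, which hides linearity. *)
declare add_bit_eq_xor [simp del] mult_bit_eq_and [simp del] bit_not_zero_iff [simp del]

text \<open>
  Everything that has to cancel below cancels in pairs: two elements can be removed from a simplex
  in either order, and two vertices with equal label can be exchanged.
\<close>

lemma sum_bit_involution:
  fixes g :: "'b \<Rightarrow> bit"
  assumes "finite X"
    and "\<And>x. x \<in> X \<Longrightarrow> \<phi> x \<in> X \<and> \<phi> (\<phi> x) = x \<and> \<phi> x \<noteq> x \<and> g (\<phi> x) = g x"
  shows "sum g X = 0"
  using assms
proof (induction X rule: finite_psubset_induct)
  case (psubset X)
  show ?case
  proof (cases "X = {}")
    case False
    then obtain x where x: "x \<in> X" by blast
    define X' where "X' = X - {x, \<phi> x}"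
    have "sum g X' = 0"
    proof (rule psubset.IH)
      show "X' \<subset> X" using x by (auto simp: X'_def)
      fix y assume y: "y \<in> X'"
      then show "\<phi> y \<in> X' \<and> \<phi> (\<phi> y) = y \<and> \<phi> y \<noteq> y \<and> g (\<phi> y) = g y"
        using psubset.prems[of y] psubset.prems[OF x] by (auto simp: X'_def)
    qed
    moreover have "X = insert x (insert (\<phi> x) X')" "x \<notin> insert (\<phi> x) X'" "\<phi> x \<notin> X'" "finite X'"
      using x psubset.prems[OF x] psubset.hyps by (auto simp: X'_def)
    ultimately have "sum g X = g x + g (\<phi> x)"
      by simp
    then show ?thesis using psubset.prems[OF x] by simp
  qed simp
qed

lemma sum_remove_two_eq_0:
  fixes g :: "'b set \<Rightarrow> bit"
  assumes "finite I"
  shows "(\<Sum>i\<in>I. \<Sum>j\<in>I - {i}. g (I - {i} - {j})) = 0"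
proof -
  have "(\<Sum>i\<in>I. \<Sum>j\<in>I - {i}. g (I - {i} - {j})) =
    (\<Sum>(i, j)\<in>(SIGMA i:I. I - {i}). g (I - {i} - {j}))"
    using assms by (subst sum.Sigma) auto
  also have "\<dots> = 0"
    by (rule sum_bit_involution[where \<phi> = prod.swap])
      (use assms in \<open>auto intro!: arg_cong[where f = g]\<close>)
  finally show ?thesis .
qed

text \<open>
  A chain is the indicator function, with values in the field with two elements, of a set of
  simplices. A simplex is the set of its vertices, so \<open>boundary\<close> is the usual simplicial boundary,
  read off at a single simplex: it counts the simplices of the chain that have \<open>\<tau>\<close> as a facet. The
  empty set is a simplex too, which makes this the augmented complex: a single point is a cycle
  only after another point has been added. The finite ambient vertex set \<open>V\<close> keeps the sum finite.
\<close>

definition boundary :: "'a set \<Rightarrow> ('a set \<Rightarrow> bit) \<Rightarrow> 'a set \<Rightarrow> bit" where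
  "boundary V C \<tau> = (\<Sum>v\<in>V - \<tau>. C (insert v \<tau>))"

definition carried :: "('a set \<Rightarrow> bit) \<Rightarrow> 'a set set \<Rightarrow> bool" where
  "carried C K \<longleftrightarrow> (\<forall>\<sigma>. C \<sigma> \<noteq> 0 \<longrightarrow> \<sigma> \<in> K)"

text \<open>
  If \<open>apart\<close> is non-adjacency, these are the simplices on \<open>n\<close> vertices of the independence complex of
  the graph induced on \<open>U\<close>.
\<close>

definition faces :: "('a \<Rightarrow> 'a \<Rightarrow> bool) \<Rightarrow> 'a set \<Rightarrow> nat \<Rightarrow> 'a set set" where
  "faces apart U n = {\<sigma>. \<sigma> \<subseteq> U \<and> pairwise apart \<sigma> \<and> card \<sigma> = n}"

text \<open>
  The cone with apex \<open>s\<close> over that part of the chain \<open>C\<close> which does not meet \<open>s\<close>. The part that already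
  contains \<open>s\<close> would only contribute degenerate simplices.
\<close>

definition cone :: "'a \<Rightarrow> ('a set \<Rightarrow> bit) \<Rightarrow> 'a set \<Rightarrow> bit" where
  "cone s C \<sigma> = (if s \<in> \<sigma> then C (\<sigma> - {s}) else 0)"

lemma boundary_add: "boundary V (\<lambda>\<sigma>. C \<sigma> + D \<sigma>) \<tau> = boundary V C \<tau> + boundary V D \<tau>"
  by (simp add: boundary_def sum.distrib)

lemma boundary_sum: "boundary V (\<lambda>\<sigma>. \<Sum>i\<in>I. C i \<sigma>) \<tau> = (\<Sum>i\<in>I. boundary V (C i) \<tau>)"
  unfolding boundary_def by (rule sum.swap)

lemma boundary_scale: "boundary V (\<lambda>\<sigma>. a * C \<sigma>) \<tau> = a * boundary V C \<tau>"
  by (simp add: boundary_def sum_distrib_left)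

lemma boundary_indicator:
  assumes "finite V" "\<sigma> \<subseteq> V"
  shows "boundary V (\<lambda>\<rho>. of_bool (\<rho> = \<sigma>)) \<tau> = (\<Sum>v\<in>\<sigma>. of_bool (\<tau> = \<sigma> - {v}))"
proof -
  have fin: "finite \<sigma>" using assms finite_subset by blast
  have "(\<Sum>v\<in>V - \<tau>. of_bool (insert v \<tau> = \<sigma>) :: bit) = (\<Sum>v\<in>V \<inter> \<sigma>. of_bool (\<tau> = \<sigma> - {v}))"
    by (rule sum.mono_neutral_cong) (use assms fin in auto)
  then show ?thesis using assms by (simp add: boundary_def Int_absorb1)
qed

text \<open>
  Write \<open>C\<close> as \<open>A\<close> plus the cone over \<open>B\<close>, where neither \<open>A\<close> nor \<open>B\<close> meets \<open>s\<close>. Comparing in the cycle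
  condition the simplices without \<open>s\<close> shows that \<open>B\<close> is the boundary of \<open>A\<close>, and then the boundary
  of the cone over \<open>A\<close> is \<open>A\<close> plus the cone over \<open>B\<close>. The two cases of the proof are these two parts.
\<close>

lemma boundary_cone:
  assumes "finite V" "s \<in> V" "\<And>\<tau>. boundary V C \<tau> = 0"
  shows "boundary V (cone s C) \<tau> = C \<tau>"
proof (cases "s \<in> \<tau>")
  case False
  have "boundary V (cone s C) \<tau> = (\<Sum>v\<in>{s}. C \<tau>)"
    unfolding boundary_def
    by (rule sum.mono_neutral_cong) (use assms False in \<open>auto simp: cone_def\<close>)
  then show ?thesis by simp
next
  case True
  have "V - (\<tau> - {s}) = insert s (V - \<tau>)" using True assms by auto
  then have "boundary V C (\<tau> - {s}) = C (insert s (\<tau> - {s})) + (\<Sum>v\<in>V - \<tau>. C (insert v (\<tau> - {s})))"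
    using True assms(1) by (simp add: boundary_def)
  moreover have "insert s (\<tau> - {s}) = \<tau>" using True by auto
  ultimately have eq: "C \<tau> + (\<Sum>v\<in>V - \<tau>. C (insert v (\<tau> - {s}))) = 0"
    using assms(3) by simp
  have "boundary V (cone s C) \<tau> = (\<Sum>v\<in>V - \<tau>. C (insert v (\<tau> - {s})))"
    unfolding boundary_def
    by (rule sum.cong) (use True in \<open>auto simp: cone_def insert_Diff_if\<close>)
  then show ?thesis using eq by (simp add: bit_add_eq_0_iff)
qed

lemma carried_cone:
  assumes "carried C (faces apart W n)" "finite W" "s \<in> W" "symp apart"
    and "\<And>x. x \<in> W \<Longrightarrow> x \<noteq> s \<Longrightarrow> apart x s"
  shows "carried (cone s C) (faces apart W (Suc n))"
  unfolding carried_def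
proof (intro allI impI)
  fix \<sigma> assume "cone s C \<sigma> \<noteq> 0"
  then have s: "s \<in> \<sigma>" and "C (\<sigma> - {s}) \<noteq> 0"
    by (auto simp: cone_def split: if_splits)
  then have face: "\<sigma> - {s} \<in> faces apart W n"
    using assms(1) by (auto simp: carried_def)
  have "pairwise apart (insert s (\<sigma> - {s}))"
  proof (rule pairwiseI)
    fix x y assume xy: "x \<in> insert s (\<sigma> - {s})" "y \<in> insert s (\<sigma> - {s})" "x \<noteq> y"
    have W: "\<sigma> - {s} \<subseteq> W" "pairwise apart (\<sigma> - {s})" using face by (auto simp: faces_def)
    show "apart x y"
    proof (cases "x = s \<or> y = s")
      case True
      then show ?thesis
      proof
        assume "x = s"
        then have "apart y x" using xy W(1) assms(5)[of y] by blast
        then show ?thesis by (rule sympD[OF assms(4)])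
      next
        assume "y = s"
        then show ?thesis using xy W(1) assms(5)[of x] by blast
      qed
    next
      case False
      then have "x \<in> \<sigma> - {s}" "y \<in> \<sigma> - {s}" using xy by auto
      then show ?thesis using W(2) xy(3) unfolding pairwise_def by blast
    qed
  qed
  moreover have "\<sigma> \<subseteq> W" using face assms(3) by (auto simp: faces_def)
  moreover have "finite \<sigma>" using \<open>\<sigma> \<subseteq> W\<close> assms(2) by (rule finite_subset)
  moreover have "card (\<sigma> - {s}) = n" using face by (simp add: faces_def)
  ultimately show "\<sigma> \<in> faces apart W (Suc n)"
    using s card_Suc_Diff1[of \<sigma> s, symmetric] by (auto simp: faces_def insert_absorb simp del: card_Diff_insert card_Diff_singleton)
qed

section \<open>Filling cycles\<close>

text \<open>
  \<open>S\<close> is an independent set, and no set of fewer than \<open>k\<close> vertices of \<open>U\<close> contains a neighbour of each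
  of its elements. A vertex does not dominate itself, which is why \<open>x = s\<close> is exempt.
\<close>

definition undominated :: "('a \<Rightarrow> 'a \<Rightarrow> bool) \<Rightarrow> 'a set \<Rightarrow> nat \<Rightarrow> 'a set \<Rightarrow> bool" where
  "undominated apart U k S \<longleftrightarrow> S \<subseteq> U \<and> pairwise apart S \<and>
     (\<forall>\<sigma> \<subseteq> U. card \<sigma> < k \<longrightarrow> (\<exists>s\<in>S. \<forall>x\<in>\<sigma>. x \<noteq> s \<longrightarrow> apart x s))"

text \<open>
  The independence complex of \<open>U\<close> is acyclic below dimension \<open>k - 1\<close>, because the inclusion of its
  skeleton in that range is null-homotopic. Suppose \<open>h\<close> is known on the proper faces of \<open>\<sigma>\<close>. Then \<open>\<sigma>\<close> plus
  the sum of \<open>h\<close> over its facets is a cycle in the independence complex of \<open>\<sigma> \<union> S\<close>. As \<open>\<sigma>\<close> has fewer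
  than \<open>k\<close> elements, some \<open>s \<in> S\<close> is apart from all other elements of \<open>\<sigma>\<close>, and being in \<open>S\<close> it is
  apart from all other elements of \<open>S\<close> too. Hence that complex is a cone with apex \<open>s\<close>, and coning the cycle defines \<open>h \<sigma>\<close>.
\<close>

lemma null_homotopy:
  assumes "finite V" "U \<subseteq> V" "symp apart" "undominated apart U k S"
  obtains h :: "'a set \<Rightarrow> 'a set \<Rightarrow> bit" where
    "\<And>\<sigma>. \<sigma> \<subseteq> U \<Longrightarrow> pairwise apart \<sigma> \<Longrightarrow> card \<sigma> < k \<Longrightarrow>
       carried (h \<sigma>) (faces apart U (Suc (card \<sigma>)))"
    "\<And>\<sigma> \<tau>. \<sigma> \<subseteq> U \<Longrightarrow> pairwise apart \<sigma> \<Longrightarrow> card \<sigma> < k \<Longrightarrow>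
       boundary V (h \<sigma>) \<tau> = of_bool (\<tau> = \<sigma>) + (\<Sum>v\<in>\<sigma>. h (\<sigma> - {v}) \<tau>)"
proof -
  define Q where "Q h \<sigma> r \<longleftrightarrow> (\<sigma> \<subseteq> U \<and> pairwise apart \<sigma> \<and> card \<sigma> < k \<longrightarrow>
      carried r (faces apart (\<sigma> \<union> S) (Suc (card \<sigma>))) \<and>
      (\<forall>\<tau>. boundary V r \<tau> = of_bool (\<tau> = \<sigma>) + (\<Sum>v\<in>\<sigma>. h (\<sigma> - {v}) \<tau>)))"
    for h :: "'a set \<Rightarrow> 'a set \<Rightarrow> bit" and \<sigma> r
  have S: "S \<subseteq> U" "pairwise apart S"
    using assms(4) by (auto simp: undominated_def)
  have finU: "finite U" using assms finite_subset by blast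
  have "\<exists>h. \<forall>\<sigma>. Q h \<sigma> (h \<sigma>)"
  proof (rule dependent_wf_choice[OF wf_finite_psubset, where P = Q])
    fix h1 h2 :: "'a set \<Rightarrow> 'a set \<Rightarrow> bit" and \<sigma> r
    assume *: "\<And>\<rho>. (\<rho>, \<sigma>) \<in> finite_psubset \<Longrightarrow> h1 \<rho> = h2 \<rho>"
    show "Q h1 \<sigma> r = Q h2 \<sigma> r"
    proof (cases "\<sigma> \<subseteq> U")
      case True
      then have "finite \<sigma>" using finU finite_subset by blast
      then have "h1 (\<sigma> - {v}) = h2 (\<sigma> - {v})" if "v \<in> \<sigma>" for v
        using that by (intro *) (auto simp: finite_psubset_def)
      then show ?thesis by (simp add: Q_def cong: sum.cong)
    qed (simp add: Q_def)
  next
    fix \<sigma> and h :: "'a set \<Rightarrow> 'a set \<Rightarrow> bit"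
    assume IH: "\<And>\<rho>. (\<rho>, \<sigma>) \<in> finite_psubset \<Longrightarrow> Q h \<rho> (h \<rho>)"
    show "\<exists>r. Q h \<sigma> r"
    proof (cases "\<sigma> \<subseteq> U \<and> pairwise apart \<sigma> \<and> card \<sigma> < k")
      case False
      then show ?thesis by (auto simp: Q_def)
    next
      case True
      then have \<sigma>: "\<sigma> \<subseteq> U" "pairwise apart \<sigma>" "card \<sigma> < k" by auto
      have fin: "finite \<sigma>" using \<sigma>(1) finU finite_subset by blast
      obtain s where s: "s \<in> S" "\<And>x. x \<in> \<sigma> \<Longrightarrow> x \<noteq> s \<Longrightarrow> apart x s"
        using assms(4) \<sigma> by (auto simp: undominated_def)
      define c where "c \<tau> = of_bool (\<tau> = \<sigma>) + (\<Sum>v\<in>\<sigma>. h (\<sigma> - {v}) \<tau>)" for \<tau>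
      have Qv: "carried (h (\<sigma> - {v})) (faces apart (\<sigma> - {v} \<union> S) (card \<sigma>))"
        "boundary V (h (\<sigma> - {v})) \<tau> =
          of_bool (\<tau> = \<sigma> - {v}) + (\<Sum>w\<in>\<sigma> - {v}. h (\<sigma> - {v} - {w}) \<tau>)" if v: "v \<in> \<sigma>" for v \<tau>
      proof -
        have "Q h (\<sigma> - {v}) (h (\<sigma> - {v}))"
          using v fin by (intro IH) (auto simp: finite_psubset_def)
        moreover have "Suc (card (\<sigma> - {v})) = card \<sigma>" using v fin by (metis card.remove)
        moreover have "pairwise apart (\<sigma> - {v})" using \<sigma>(2) pairwise_subset by blast
        ultimately show "carried (h (\<sigma> - {v})) (faces apart (\<sigma> - {v} \<union> S) (card \<sigma>))"
          "boundary V (h (\<sigma> - {v})) \<tau> =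
          of_bool (\<tau> = \<sigma> - {v}) + (\<Sum>w\<in>\<sigma> - {v}. h (\<sigma> - {v} - {w}) \<tau>)"
          using \<sigma> by (auto simp: Q_def simp del: card_Diff_insert)
      qed
      \<comment> \<open>The boundary of \<open>\<sigma>\<close> cancels against the leading terms of the boundaries of \<open>h (\<sigma> - {v})\<close>; in the
        remaining double sum, \<open>v\<close> and \<open>w\<close> are removed in both orders.\<close>
      have cyc: "boundary V c \<tau> = 0" for \<tau>
      proof -
        have "boundary V c \<tau> = (\<Sum>v\<in>\<sigma>. of_bool (\<tau> = \<sigma> - {v})) +
           (\<Sum>v\<in>\<sigma>. boundary V (h (\<sigma> - {v})) \<tau>)"
          unfolding c_def boundary_add boundary_sum
          using boundary_indicator[of V \<sigma> \<tau>] assms(1,2) \<sigma>(1) by simp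
        also have "(\<Sum>v\<in>\<sigma>. boundary V (h (\<sigma> - {v})) \<tau>) =
          (\<Sum>v\<in>\<sigma>. of_bool (\<tau> = \<sigma> - {v})) + (\<Sum>v\<in>\<sigma>. \<Sum>w\<in>\<sigma> - {v}. h (\<sigma> - {v} - {w}) \<tau>)"
          by (simp add: Qv sum.distrib)
        also have "(\<Sum>v\<in>\<sigma>. \<Sum>w\<in>\<sigma> - {v}. h (\<sigma> - {v} - {w}) \<tau>) = 0"
          using sum_remove_two_eq_0[OF fin, of "\<lambda>\<rho>. h \<rho> \<tau>"] .
        finally show ?thesis by simp
      qed
      have "carried c (faces apart (\<sigma> \<union> S) (card \<sigma>))"
        unfolding carried_def
      proof (intro allI impI)
        fix \<tau> assume "c \<tau> \<noteq> 0"
        then have "\<tau> = \<sigma> \<or> (\<exists>v\<in>\<sigma>. h (\<sigma> - {v}) \<tau> \<noteq> 0)"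
          unfolding c_def by (cases "\<tau> = \<sigma>") (auto dest: sum.not_neutral_contains_not_neutral)
        then show "\<tau> \<in> faces apart (\<sigma> \<union> S) (card \<sigma>)"
          using \<sigma> Qv(1) unfolding carried_def faces_def by blast
      qed
      then have "carried (cone s c) (faces apart (\<sigma> \<union> S) (Suc (card \<sigma>)))"
      proof (rule carried_cone)
        show "finite (\<sigma> \<union> S)" using \<sigma>(1) S(1) finU by (meson Un_least finite_subset)
        show "apart x s" if "x \<in> \<sigma> \<union> S" "x \<noteq> s" for x
          using that s S(2) by (auto simp: pairwise_def)
      qed (use s assms(3) in auto)
      moreover have "boundary V (cone s c) \<tau> = c \<tau>" for \<tau>
        by (rule boundary_cone) (use cyc s S assms in auto)
      ultimately show ?thesis by (auto simp: Q_def c_def)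
    qed
  qed
  then obtain h where h: "\<And>\<sigma>. Q h \<sigma> (h \<sigma>)" by blast
  show thesis
  proof (rule that[of h])
    fix \<sigma> assume "\<sigma> \<subseteq> U" "pairwise apart \<sigma>" "card \<sigma> < k"
    then show "carried (h \<sigma>) (faces apart U (Suc (card \<sigma>)))"
      using h[of \<sigma>] S unfolding Q_def carried_def faces_def by blast
  next
    fix \<sigma> \<tau> assume "\<sigma> \<subseteq> U" "pairwise apart \<sigma>" "card \<sigma> < k"
    then show "boundary V (h \<sigma>) \<tau> = of_bool (\<tau> = \<sigma>) + (\<Sum>v\<in>\<sigma>. h (\<sigma> - {v}) \<tau>)"
      using h[of \<sigma>] unfolding Q_def by blast
  qed
qed

text \<open>
  The homotopy, extended linearly, is applied to the cycle; the correction terms assemble to the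
  boundary of \<open>z\<close>, which vanishes.
\<close>

lemma fill_cycle:
  assumes "finite V" "U \<subseteq> V" "symp apart" "undominated apart U k S" "q < k"
    and z: "carried z (faces apart U q)" and cyc: "\<And>\<tau>. boundary V z \<tau> = 0"
  obtains w where "carried w (faces apart U (Suc q))" "\<And>\<tau>. boundary V w \<tau> = z \<tau>"
proof -
  obtain h where h1: "\<And>\<sigma>. \<sigma> \<subseteq> U \<Longrightarrow> pairwise apart \<sigma> \<Longrightarrow> card \<sigma> < k \<Longrightarrow>
       carried (h \<sigma>) (faces apart U (Suc (card \<sigma>)))"
    and h2: "\<And>\<sigma> \<tau>. \<sigma> \<subseteq> U \<Longrightarrow> pairwise apart \<sigma> \<Longrightarrow> card \<sigma> < k \<Longrightarrow>
       boundary V (h \<sigma>) \<tau> = of_bool (\<tau> = \<sigma>) + (\<Sum>v\<in>\<sigma>. h (\<sigma> - {v}) \<tau>)"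
    by (rule null_homotopy[OF assms(1-4)]) blast
  define w where "w \<tau> = (\<Sum>\<sigma>\<in>Pow V. z \<sigma> * h \<sigma> \<tau>)" for \<tau>
  have zD: "\<sigma> \<subseteq> U" "pairwise apart \<sigma>" "card \<sigma> = q" if "z \<sigma> \<noteq> 0" for \<sigma>
    using z that by (auto simp: carried_def faces_def)
  have "carried w (faces apart U (Suc q))"
    unfolding carried_def
  proof (intro allI impI)
    fix \<tau> assume "w \<tau> \<noteq> 0"
    then obtain \<sigma> where "z \<sigma> * h \<sigma> \<tau> \<noteq> 0"
      unfolding w_def by (meson sum.neutral)
    then have "z \<sigma> \<noteq> 0" "h \<sigma> \<tau> \<noteq> 0" by auto
    then show "\<tau> \<in> faces apart U (Suc q)"
      using h1[of \<sigma>] zD[of \<sigma>] assms(5) by (auto simp: carried_def)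
  qed
  moreover have "boundary V w \<tau> = z \<tau>" for \<tau>
  proof -
    have "boundary V w \<tau> = (\<Sum>\<sigma>\<in>Pow V. z \<sigma> * boundary V (h \<sigma>) \<tau>)"
      unfolding w_def boundary_sum boundary_scale ..
    also have "\<dots> = (\<Sum>\<sigma>\<in>Pow V. z \<sigma> * of_bool (\<tau> = \<sigma>) + (\<Sum>v\<in>\<sigma>. z \<sigma> * h (\<sigma> - {v}) \<tau>))"
    proof (rule sum.cong[OF refl])
      fix \<sigma>
      show "z \<sigma> * boundary V (h \<sigma>) \<tau> =
        z \<sigma> * of_bool (\<tau> = \<sigma>) + (\<Sum>v\<in>\<sigma>. z \<sigma> * h (\<sigma> - {v}) \<tau>)"
      proof (cases "z \<sigma> = 0")
        case False
        then show ?thesis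
          using h2[of \<sigma> \<tau>] zD[of \<sigma>] assms(5) by (simp add: distrib_left sum_distrib_left)
      qed simp
    qed
    also have "\<dots> = (\<Sum>\<sigma>\<in>Pow V. z \<sigma> * of_bool (\<tau> = \<sigma>)) +
        (\<Sum>\<sigma>\<in>Pow V. \<Sum>v\<in>\<sigma>. z \<sigma> * h (\<sigma> - {v}) \<tau>)"
      by (rule sum.distrib)
    also have "(\<Sum>\<sigma>\<in>Pow V. z \<sigma> * of_bool (\<tau> = \<sigma>)) = z \<tau>"
    proof -
      have "(\<Sum>\<sigma>\<in>Pow V. z \<sigma> * of_bool (\<tau> = \<sigma>)) = (\<Sum>\<sigma>\<in>Pow V. if \<tau> = \<sigma> then z \<sigma> else 0)"
        by (rule sum.cong) auto
      also have "\<dots> = z \<tau>"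
        using assms(1,2) zD(1)[of \<tau>] by (auto simp: sum.delta')
      finally show ?thesis .
    qed
    also have "(\<Sum>\<sigma>\<in>Pow V. \<Sum>v\<in>\<sigma>. z \<sigma> * h (\<sigma> - {v}) \<tau>) =
      (\<Sum>(\<sigma>, v)\<in>(SIGMA \<sigma>:Pow V. \<sigma>). z \<sigma> * h (\<sigma> - {v}) \<tau>)"
      using assms(1) finite_subset by (subst sum.Sigma) auto
    \<comment> \<open>regroup by the facet \<open>\<rho> = \<sigma> - {v}\<close>, which produces the boundary of \<open>z\<close> at \<open>\<rho>\<close>\<close>
    also have "\<dots> = (\<Sum>(\<rho>, v)\<in>(SIGMA \<rho>:Pow V. V - \<rho>). z (insert v \<rho>) * h \<rho> \<tau>)"
      by (rule sum.reindex_bij_witness[where i = "\<lambda>(\<rho>, v). (insert v \<rho>, v)"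
            and j = "\<lambda>(\<sigma>, v). (\<sigma> - {v}, v)"]) (auto simp: insert_absorb)
    also have "\<dots> = (\<Sum>\<rho>\<in>Pow V. boundary V z \<rho> * h \<rho> \<tau>)"
      using assms(1) unfolding boundary_def by (subst sum.Sigma[symmetric]) (auto simp: sum_distrib_right)
    also have "\<dots> = 0" using cyc by simp
    finally show ?thesis by simp
  qed
  ultimately show thesis by (rule that)
qed

section \<open>A topological Hall theorem\<close>

text \<open>
  A set with one element of each label in \<open>J\<close>, enlarged by a further element \<open>v\<close> with label in \<open>J\<close>, has
  exactly two subsets of the first kind, and this swaps them.
\<close>

lemma exchange_representative:
  assumes "bij_betw f \<tau> J" "v \<notin> \<tau>" "f v \<in> J"
  defines "u \<equiv> the_inv_into \<tau> f (f v)"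
  shows "u \<in> \<tau>" "f u = f v" "bij_betw f (insert v (\<tau> - {u})) J"
    "the_inv_into (insert v (\<tau> - {u})) f (f u) = v"
proof -
  have inj: "inj_on f \<tau>" and im: "f ` \<tau> = J" using assms(1) by (auto simp: bij_betw_def)
  have im': "f v \<in> f ` \<tau>" using im assms(3) by simp
  show u: "u \<in> \<tau>" "f u = f v"
    using the_inv_into_into[OF inj im' subset_refl] f_the_inv_into_f[OF inj im'] by (auto simp: u_def)
  have inj': "inj_on f (insert v (\<tau> - {u}))"
    using inj u by (auto simp: inj_on_def)
  moreover have "f ` (insert v (\<tau> - {u})) = J"
  proof -
    have "f ` (insert v (\<tau> - {u})) = f ` insert u (\<tau> - {u})"
      unfolding image_insert using u(2) by simp
    also have "insert u (\<tau> - {u}) = \<tau>" using u(1) by blast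
    finally show ?thesis using im by simp
  qed
  ultimately show "bij_betw f (insert v (\<tau> - {u})) J" by (simp add: bij_betw_def)
  show "the_inv_into (insert v (\<tau> - {u})) f (f u) = v"
    using the_inv_into_f_f[OF inj', of v] u(2) by simp
qed

text \<open>
  This is the parity count in Sperner's lemma. Among the facets of a simplex whose labels lie in
  \<open>insert i J\<close>, the number of those carrying each label of \<open>J\<close> exactly once is one if the simplex
  carries each label of \<open>insert i J\<close> exactly once, and otherwise it is zero or two.
\<close>

lemma sum_boundary_transversals:
  fixes C :: "'a set \<Rightarrow> bit"
  assumes "finite V" "i \<notin> J"
    and supp: "\<And>\<sigma>. C \<sigma> \<noteq> 0 \<Longrightarrow> f ` \<sigma> \<subseteq> insert i J"
  shows "(\<Sum>\<tau> | \<tau> \<subseteq> V \<and> bij_betw f \<tau> J. boundary V C \<tau>) =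
    (\<Sum>\<sigma> | \<sigma> \<subseteq> V \<and> bij_betw f \<sigma> (insert i J). C \<sigma>)"
proof -
  define R where "R I = {\<tau>. \<tau> \<subseteq> V \<and> bij_betw f \<tau> I}" for I
  have finR: "finite (R I)" for I
    by (rule finite_subset[of _ "Pow V"]) (use assms(1) in \<open>auto simp: R_def\<close>)
  \<comment> \<open>The incidences \<open>(\<tau>, v)\<close> with \<open>f v = i\<close> are the transversals of \<open>insert i J\<close>. Those where the
    label of \<open>v\<close> occurs in \<open>\<tau>\<close> already come in pairs.\<close>
  define P where "P = (SIGMA \<tau>:R J. V - \<tau>)"
  define P1 where "P1 = {p \<in> P. f (snd p) = i}"
  define P2 where "P2 = {p \<in> P. f (snd p) \<in> J}"
  define g where "g p = C (insert (snd p) (fst p))" for p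
  have finP: "finite P" using finR assms(1) by (auto simp: P_def)
  have "(\<Sum>\<tau>\<in>R J. boundary V C \<tau>) = sum g P"
    unfolding boundary_def P_def g_def using finR assms(1)
    by (subst sum.Sigma) (auto simp: case_prod_beta)
  also have "\<dots> = sum g (P1 \<union> P2)"
  proof (rule sum.mono_neutral_right[OF finP])
    show "\<forall>p\<in>P - (P1 \<union> P2). g p = 0"
    proof
      fix p assume p: "p \<in> P - (P1 \<union> P2)"
      then have "f (snd p) \<notin> insert i J" by (auto simp: P1_def P2_def)
      then have "\<not> f ` insert (snd p) (fst p) \<subseteq> insert i J" by blast
      then show "g p = 0" using supp[of "insert (snd p) (fst p)"] unfolding g_def by blast
    qed
  qed (auto simp: P1_def P2_def)
  also have "\<dots> = sum g P1 + sum g P2"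
    by (rule sum.union_disjoint) (use finP assms(2) in \<open>auto simp: P1_def P2_def\<close>)
  also have "sum g P2 = 0"
  proof -
    define swap where "swap p = (let u = the_inv_into (fst p) f (f (snd p)) in
      (insert (snd p) (fst p - {u}), u))" for p
    have "swap p \<in> P2 \<and> swap (swap p) = p \<and> swap p \<noteq> p \<and> g (swap p) = g p" if "p \<in> P2" for p
    proof -
      obtain \<tau> v where p: "p = (\<tau>, v)" by force
      have v: "\<tau> \<subseteq> V" "bij_betw f \<tau> J" "v \<in> V" "v \<notin> \<tau>" "f v \<in> J"
        using that by (auto simp: p P2_def P_def R_def)
      define u where "u = the_inv_into \<tau> f (f v)"
      note u = exchange_representative[OF v(2,4,5), folded u_def]
      have sw: "swap p = (insert v (\<tau> - {u}), u)" by (simp add: swap_def p u_def Let_def)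
      have "u \<noteq> v" using u(1) v(4) by auto
      moreover have "insert u (insert v (\<tau> - {u}) - {v}) = \<tau>"
        using u(1) v(4) by auto
      ultimately have "swap (swap p) = p"
        unfolding sw unfolding swap_def p using u(4) by (simp add: Let_def)
      moreover have "swap p \<in> P2"
        using u v \<open>u \<noteq> v\<close> unfolding sw by (auto simp: P2_def P_def R_def)
      moreover have "swap p \<noteq> p" using \<open>u \<noteq> v\<close> unfolding sw by (simp add: p)
      moreover have "insert u (insert v (\<tau> - {u})) = insert v \<tau>" using u(1) by blast
      then have "g (swap p) = g p" unfolding sw by (simp add: g_def p)
      ultimately show ?thesis by blast
    qed
    then show ?thesis
      using finP by (intro sum_bit_involution[where \<phi> = swap]) (auto simp: P2_def)
  qed
  also have "sum g P1 = (\<Sum>\<sigma>\<in>R (insert i J). C \<sigma>)"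
  proof (rule sum.reindex_bij_betw[of "\<lambda>p. insert (snd p) (fst p)" P1 _ C, folded g_def])
    show "bij_betw (\<lambda>p. insert (snd p) (fst p)) P1 (R (insert i J))"
    proof (rule bij_betw_byWitness[where f' = "\<lambda>\<sigma>. (\<sigma> - {the_inv_into \<sigma> f i}, the_inv_into \<sigma> f i)"])
      have *: "bij_betw f (insert v \<tau>) (insert i J)" "the_inv_into (insert v \<tau>) f i = v"
        if "bij_betw f \<tau> J" "f v = i" for \<tau> v
      proof -
        show "bij_betw f (insert v \<tau>) (insert i J)"
          using that assms(2) by (auto simp: bij_betw_def)
        then show "the_inv_into (insert v \<tau>) f i = v"
          using that(2) by (auto simp: bij_betw_def intro!: the_inv_into_f_eq)
      qed
      show "\<forall>p\<in>P1. (insert (snd p) (fst p) - {the_inv_into (insert (snd p) (fst p)) f i},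
          the_inv_into (insert (snd p) (fst p)) f i) = p"
        by (auto simp: P1_def P_def R_def *)
      show "(\<lambda>p. insert (snd p) (fst p)) ` P1 \<subseteq> R (insert i J)"
      proof (rule image_subsetI)
        fix p assume "p \<in> P1"
        then have "fst p \<subseteq> V" "snd p \<in> V" "bij_betw f (fst p) J" "f (snd p) = i"
          by (auto simp: P1_def P_def R_def)
        then show "insert (snd p) (fst p) \<in> R (insert i J)"
          using *(1) by (simp add: R_def)
      qed
      have **: "the_inv_into \<sigma> f i \<in> \<sigma>" "f (the_inv_into \<sigma> f i) = i"
        "bij_betw f (\<sigma> - {the_inv_into \<sigma> f i}) J" if "bij_betw f \<sigma> (insert i J)" for \<sigma>
      proof -
        have inj: "inj_on f \<sigma>" and im: "f ` \<sigma> = insert i J" using that by (auto simp: bij_betw_def)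
        have im': "i \<in> f ` \<sigma>" using im by simp
        show 1: "the_inv_into \<sigma> f i \<in> \<sigma>" by (rule the_inv_into_into[OF inj im' subset_refl])
        show 2: "f (the_inv_into \<sigma> f i) = i" by (rule f_the_inv_into_f[OF inj im'])
        have "f ` (\<sigma> - {the_inv_into \<sigma> f i}) = J"
          using inj_on_image_set_diff[OF inj, of \<sigma> "{the_inv_into \<sigma> f i}"] 1 2 im assms(2) by simp
        then show "bij_betw f (\<sigma> - {the_inv_into \<sigma> f i}) J"
          using inj by (auto simp: bij_betw_def intro: inj_on_subset)
      qed
      show "\<forall>\<sigma>\<in>R (insert i J). insert (snd (\<sigma> - {the_inv_into \<sigma> f i}, the_inv_into \<sigma> f i))
          (fst (\<sigma> - {the_inv_into \<sigma> f i}, the_inv_into \<sigma> f i)) = \<sigma>"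
        using **(1) by (auto simp: R_def)
      show "(\<lambda>\<sigma>. (\<sigma> - {the_inv_into \<sigma> f i}, the_inv_into \<sigma> f i)) ` R (insert i J) \<subseteq> P1"
        using ** by (auto simp: R_def P1_def P_def)
    qed
  qed
  finally show ?thesis by (simp add: R_def)
qed

text \<open>
  A chain map from the full simplex on the label set \<open>A\<close> to the independence complex on \<open>V\<close>, which
  sends every face \<open>I\<close> into the part spanned by the vertices with labels in \<open>I\<close>. It is built by
  induction on \<open>I\<close>: the images of the facets of \<open>I\<close> form a cycle of simplices with \<open>card I - 1\<close>
  vertices, and the hypothesis on \<open>I\<close> lets it be filled.
\<close>

lemma exists_filling_system:
  fixes V :: "'a set" and f :: "'a \<Rightarrow> 'i"
  assumes "finite V" "finite A" "symp apart"
    and und: "\<And>I. I \<subseteq> A \<Longrightarrow> I \<noteq> {} \<Longrightarrow> \<exists>S. undominated apart {v \<in> V. f v \<in> I} (card I) S"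
  shows "\<exists>w :: 'i set \<Rightarrow> 'a set \<Rightarrow> bit. w {} {} = 1 \<and>
    (\<forall>I \<subseteq> A. carried (w I) (faces apart {v \<in> V. f v \<in> I} (card I)) \<and>
      (\<forall>\<tau>. boundary V (w I) \<tau> = (\<Sum>i\<in>I. w (I - {i}) \<tau>)))"
proof -
  define U where "U I = {v \<in> V. f v \<in> I}" for I
  define Q where "Q w I r \<longleftrightarrow> (I \<subseteq> A \<longrightarrow> carried r (faces apart (U I) (card I)) \<and>
      (I = {} \<longrightarrow> r {} = 1) \<and> (\<forall>\<tau>. boundary V r \<tau> = (\<Sum>i\<in>I. w (I - {i}) \<tau>)))"
    for w :: "'i set \<Rightarrow> 'a set \<Rightarrow> bit" and I r
  have "\<exists>w. \<forall>I. Q w I (w I)"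
  proof (rule dependent_wf_choice[OF wf_finite_psubset, where P = Q])
    fix w1 w2 :: "'i set \<Rightarrow> 'a set \<Rightarrow> bit" and I r
    assume *: "\<And>J. (J, I) \<in> finite_psubset \<Longrightarrow> w1 J = w2 J"
    show "Q w1 I r = Q w2 I r"
    proof (cases "I \<subseteq> A")
      case True
      then have "finite I" using assms(2) finite_subset by blast
      then have "w1 (I - {i}) = w2 (I - {i})" if "i \<in> I" for i
        using that by (intro *) (auto simp: finite_psubset_def)
      then show ?thesis by (simp add: Q_def cong: sum.cong)
    qed (simp add: Q_def)
  next
    fix I and w :: "'i set \<Rightarrow> 'a set \<Rightarrow> bit"
    assume IH: "\<And>J. (J, I) \<in> finite_psubset \<Longrightarrow> Q w J (w J)"
    consider "\<not> I \<subseteq> A" | "I = {}" | "I \<subseteq> A" "I \<noteq> {}" by blast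
    then show "\<exists>r. Q w I r"
    proof cases
      case 1
      then show ?thesis by (auto simp: Q_def)
    next
      case 2
      then have "Q w I (\<lambda>\<sigma>. of_bool (\<sigma> = {}))"
        by (auto simp: Q_def carried_def faces_def boundary_def)
      then show ?thesis by blast
    next
      case 3
      have fin: "finite I" using 3 assms(2) finite_subset by blast
      define z where "z \<tau> = (\<Sum>i\<in>I. w (I - {i}) \<tau>)" for \<tau>
      have Qi: "carried (w (I - {i})) (faces apart (U (I - {i})) (card I - 1))"
        "boundary V (w (I - {i})) \<tau> = (\<Sum>j\<in>I - {i}. w (I - {i} - {j}) \<tau>)" if i: "i \<in> I" for i \<tau>
      proof -
        have "Q w (I - {i}) (w (I - {i}))"
          using i fin by (intro IH) (auto simp: finite_psubset_def)
        then show "carried (w (I - {i})) (faces apart (U (I - {i})) (card I - 1))"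
          "boundary V (w (I - {i})) \<tau> = (\<Sum>j\<in>I - {i}. w (I - {i} - {j}) \<tau>)"
          using 3 i by (auto simp: Q_def)
      qed
      obtain S where S: "undominated apart (U I) (card I) S"
        using und[OF 3] by (auto simp: U_def)
      have cyc: "boundary V z \<tau> = 0" for \<tau>
      proof -
        have "boundary V z \<tau> = (\<Sum>i\<in>I. \<Sum>j\<in>I - {i}. w (I - {i} - {j}) \<tau>)"
          unfolding z_def boundary_sum by (rule sum.cong[OF refl]) (rule Qi(2))
        also have "\<dots> = 0" by (rule sum_remove_two_eq_0[OF fin, of "\<lambda>J. w J \<tau>"])
        finally show ?thesis .
      qed
      have "carried z (faces apart (U I) (card I - 1))"
        unfolding carried_def
      proof (intro allI impI)
        fix \<tau> assume "z \<tau> \<noteq> 0"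
        then obtain i where "i \<in> I" "w (I - {i}) \<tau> \<noteq> 0"
          unfolding z_def by (meson sum.neutral)
        then have "\<tau> \<in> faces apart (U (I - {i})) (card I - 1)"
          using Qi(1) by (auto simp: carried_def)
        then show "\<tau> \<in> faces apart (U I) (card I - 1)" by (auto simp: faces_def U_def)
      qed
      moreover have "U I \<subseteq> V" by (auto simp: U_def)
      moreover have "0 < card I" using 3 fin by (simp add: card_gt_0_iff)
      ultimately obtain r where "carried r (faces apart (U I) (card I))" "\<And>\<tau>. boundary V r \<tau> = z \<tau>"
        using fill_cycle[OF assms(1) _ assms(3) S, of "card I - 1" z] cyc by auto
      then have "Q w I r" using 3 by (simp add: Q_def z_def)
      then show ?thesis by blast
    qed
  qed
  then obtain w where w: "\<And>I. Q w I (w I)" by blast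
  show ?thesis
    by (rule exI[of _ w]) (use w w[of "{}"] in \<open>simp add: Q_def U_def\<close>)
qed

text \<open>
  The topological Hall theorem of Aharoni and Haxell, with its connectivity hypothesis replaced by
  domination. By the parity count, the image of every face \<open>I\<close> contains an odd number of
  transversals of \<open>I\<close>; so there is one for \<open>I = A\<close>.
\<close>

theorem hall_transversal:
  assumes "finite V" "finite A" "symp apart"
    and "\<And>I. I \<subseteq> A \<Longrightarrow> I \<noteq> {} \<Longrightarrow> \<exists>S. undominated apart {v \<in> V. f v \<in> I} (card I) S"
  obtains T where "T \<subseteq> V" "pairwise apart T" "bij_betw f T A"
proof -
  obtain w where w: "\<And>I. I \<subseteq> A \<Longrightarrow> carried (w I) (faces apart {v \<in> V. f v \<in> I} (card I))"
    "w {} {} = 1"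
    "\<And>I \<tau>. I \<subseteq> A \<Longrightarrow> boundary V (w I) \<tau> = (\<Sum>i\<in>I. w (I - {i}) \<tau>)"
    using exists_filling_system[OF assms] by blast
  define R where "R I = {\<tau>. \<tau> \<subseteq> V \<and> bij_betw f \<tau> I}" for I
  have odd: "sum (w I) (R I) = 1" if "I \<subseteq> A" for I
    using finite_subset[OF that assms(2)] that
  proof (induction I rule: finite_induct)
    case empty
    have "R {} = {{}}" by (auto simp: R_def bij_betw_def)
    then show ?case using w(2) by simp
  next
    case (insert i J)
    have "f ` \<sigma> \<subseteq> insert i J" if "w (insert i J) \<sigma> \<noteq> 0" for \<sigma>
      using w(1)[OF insert.prems] that by (auto simp: carried_def faces_def)
    then have "sum (w (insert i J)) (R (insert i J)) = (\<Sum>\<tau>\<in>R J. boundary V (w (insert i J)) \<tau>)"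
      using sum_boundary_transversals[OF assms(1) insert.hyps(2), of "w (insert i J)" f]
      by (simp add: R_def)
    also have "\<dots> = (\<Sum>\<tau>\<in>R J. w J \<tau>)"
    proof (rule sum.cong[OF refl])
      fix \<tau> assume \<tau>: "\<tau> \<in> R J"
      have "w (insert i J - {j}) \<tau> = 0" if "j \<in> J" for j
      proof (rule ccontr)
        assume "w (insert i J - {j}) \<tau> \<noteq> 0"
        then have "f ` \<tau> \<subseteq> insert i J - {j}"
          using w(1)[of "insert i J - {j}"] insert.prems by (auto simp: carried_def faces_def)
        then show False using \<tau> that by (auto simp: R_def bij_betw_def)
      qed
      then have "(\<Sum>j\<in>J. w (insert i J - {j}) \<tau>) = 0" by (simp add: sum.neutral)
      then show "boundary V (w (insert i J)) \<tau> = w J \<tau>"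
        using w(3)[OF insert.prems, of \<tau>] insert.hyps by simp
    qed
    also have "\<dots> = 1" using insert by simp
    finally show ?case .
  qed
  have "sum (w A) (R A) \<noteq> 0" using odd[of A] by simp
  then obtain T where T: "T \<in> R A" "w A T \<noteq> 0" by (meson sum.neutral)
  then have "pairwise apart T" using w(1)[of A] by (auto simp: carried_def faces_def)
  then show thesis using T by (intro that[of T]) (auto simp: R_def)
qed

section \<open>Partial transversals and the tripartite cover theorem\<close>

lemma card_sum_type:
  fixes \<sigma> :: "('a + 'b) set"
  assumes "finite \<sigma>"
  shows "card \<sigma> = card (Inl -` \<sigma>) + card (Inr -` \<sigma>)"
proof -
  have "\<sigma> = Inl ` (Inl -` \<sigma>) \<union> Inr ` (Inr -` \<sigma>)"
  proof (rule set_eqI)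
    fix x show "x \<in> \<sigma> \<longleftrightarrow> x \<in> Inl ` (Inl -` \<sigma>) \<union> Inr ` (Inr -` \<sigma>)"
      by (cases x) auto
  qed
  then have "card \<sigma> = card (Inl ` (Inl -` \<sigma>) \<union> Inr ` (Inr -` \<sigma>))" by simp
  also have "\<dots> = card (Inl ` (Inl -` \<sigma>) :: ('a + 'b) set) + card (Inr ` (Inr -` \<sigma>) :: ('a + 'b) set)"
    using assms by (subst card_Un_disjoint) (auto simp: finite_vimageI simp del: image_vimage_eq)
  finally show ?thesis by (simp add: card_image del: image_vimage_eq)
qed

text \<open>
  To allow a deficiency \<open>d\<close>, every label receives \<open>d\<close> dummy vertices, numbered by \<open>j < d\<close>, and two
  dummies conflict exactly if they have the same number. One dummy for each number extends \<open>S\<close> to an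
  independent set; to dominate it, a dominating set must spend \<open>d\<close> dummies on these new elements.
  A transversal uses each number at most once, so all but \<open>d\<close> of its elements are genuine.
\<close>

theorem hall_partial_transversal:
  fixes V :: "'a set" and f :: "'a \<Rightarrow> 'i"
  assumes "finite V" "finite A" "symp apart"
    and und: "\<And>I. I \<subseteq> A \<Longrightarrow> I \<noteq> {} \<Longrightarrow> \<exists>S. undominated apart {v \<in> V. f v \<in> I} (card I - d) S"
  obtains T where "T \<subseteq> V" "pairwise apart T" "inj_on f T" "card A \<le> card T + d"
proof -
  define V' :: "('a + 'i \<times> nat) set" where "V' = Inl ` V \<union> Inr ` (A \<times> {..<d})"
  define f' :: "'a + 'i \<times> nat \<Rightarrow> 'i" where "f' = case_sum f fst"
  define apart' where "apart' x y = (case (x, y) of (Inl u, Inl v) \<Rightarrow> apart u v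
      | (Inr p, Inr q) \<Rightarrow> snd p \<noteq> snd q | _ \<Rightarrow> True)" for x y :: "'a + 'i \<times> nat"
  have "\<exists>S. undominated apart' {v \<in> V'. f' v \<in> I} (card I) S" if I: "I \<subseteq> A" "I \<noteq> {}" for I
  proof -
    obtain S where S: "undominated apart {v \<in> V. f v \<in> I} (card I - d) S" using und[OF I] by blast
    have S1: "S \<subseteq> {v \<in> V. f v \<in> I}" and S2: "pairwise apart S"
      using S unfolding undominated_def by blast+
    obtain i where i: "i \<in> I" using I by blast
    define S' where "S' = Inl ` S \<union> (\<lambda>j. Inr (i, j)) ` {..<d}"
    have "S' \<subseteq> {v \<in> V'. f' v \<in> I}"
      using S1 i I by (auto simp: S'_def V'_def f'_def)
    moreover have "pairwise apart' S'"
      unfolding S'_def pairwise_def apart'_def by (auto intro: pairwiseD[OF S2])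
    moreover have "\<exists>s\<in>S'. \<forall>x\<in>\<sigma>. x \<noteq> s \<longrightarrow> apart' x s"
      if \<sigma>: "\<sigma> \<subseteq> {v \<in> V'. f' v \<in> I}" "card \<sigma> < card I" for \<sigma>
      \<comment> \<open>If \<open>\<sigma>\<close> misses the dummy number \<open>j\<close>, that dummy is undominated. Otherwise \<open>\<sigma>\<close> has at least \<open>d\<close>
        dummies, and its remaining elements are too few to dominate \<open>S\<close>.\<close>
    proof (cases "{..<d} \<subseteq> snd ` (Inr -` \<sigma>)")
      case False
      then obtain j where "j < d" "j \<notin> snd ` (Inr -` \<sigma>)" by blast
      then have "Inr (i, j) \<in> S'" "\<forall>x\<in>\<sigma>. apart' x (Inr (i, j))"
        by (force simp: S'_def apart'_def split: sum.split)+
      then show ?thesis by blast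
    next
      case True
      have fin\<sigma>: "finite \<sigma>"
        by (rule finite_subset[of _ V']) (use \<sigma> assms in \<open>auto simp: V'_def\<close>)
      have fin: "finite (Inl -` \<sigma>)" "finite (Inr -` \<sigma>)"
        using fin\<sigma> by (simp_all add: finite_vimageI)
      have "d \<le> card (snd ` (Inr -` \<sigma>))" using card_mono[OF _ True] fin by simp
      also have "\<dots> \<le> card (Inr -` \<sigma>)" by (rule card_image_le[OF fin(2)])
      finally have d: "d \<le> card (Inr -` \<sigma>)" .
      have "card (Inl -` \<sigma>) < card I - d"
        using d \<sigma>(2) card_sum_type[OF fin\<sigma>] by linarith
      moreover have "Inl -` \<sigma> \<subseteq> {v \<in> V. f v \<in> I}" using \<sigma>(1) by (auto simp: V'_def f'_def)
      ultimately obtain s where "s \<in> S" "\<forall>x\<in>Inl -` \<sigma>. x \<noteq> s \<longrightarrow> apart x s"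
        using S unfolding undominated_def by blast
      then have "Inl s \<in> S'" "\<forall>x\<in>\<sigma>. x \<noteq> Inl s \<longrightarrow> apart' x (Inl s)"
        by (auto simp: S'_def apart'_def split: sum.split)
      then show ?thesis by blast
    qed
    ultimately show ?thesis unfolding undominated_def by blast
  qed
  moreover have "finite V'" using assms by (simp add: V'_def)
  moreover have "symp apart'"
    using assms(3) by (auto simp: symp_def apart'_def split: sum.split)
  ultimately obtain T' where T': "T' \<subseteq> V'" "pairwise apart' T'" "bij_betw f' T' A"
    using hall_transversal[of V' A apart' f'] assms(2) by blast
  define T where "T = Inl -` T'"
  have finT': "finite T'" using T'(1) \<open>finite V'\<close> finite_subset by blast
  have fin: "finite T" "finite (Inr -` T')"
    using finT' by (simp_all add: T_def finite_vimageI)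
  have "inj_on snd (Inr -` T')"
    using T'(2) by (fastforce simp: inj_on_def pairwise_def apart'_def)
  then have "card (Inr -` T') = card (snd ` (Inr -` T'))" by (simp add: card_image)
  also have "\<dots> \<le> card {..<d}"
    by (rule card_mono) (use T'(1) in \<open>auto simp: V'_def\<close>)
  finally have d: "card (Inr -` T') \<le> d" by simp
  have "card A \<le> card T + d"
    using d bij_betw_same_card[OF T'(3)] card_sum_type[OF finT'] by (simp add: T_def)
  moreover have "T \<subseteq> V" using T'(1) by (auto simp: T_def V'_def)
  moreover have "pairwise apart T"
  proof (rule pairwiseI)
    fix x y assume "x \<in> T" "y \<in> T" "x \<noteq> y"
    then have "apart' (Inl x) (Inl y)" by (intro pairwiseD[OF T'(2)]) (auto simp: T_def)
    then show "apart x y" by (simp add: apart'_def)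
  qed
  moreover have "inj_on f T"
  proof (rule inj_onI)
    fix x y assume "x \<in> T" "y \<in> T" "f x = f y"
    then have "(Inl x :: 'a + 'i \<times> nat) = Inl y"
      using T'(3) unfolding bij_betw_def by (intro inj_onD[of f' T']) (auto simp: T_def f'_def)
    then show "x = y" by simp
  qed
  ultimately show thesis by (rule that[rotated 3])
qed

text \<open>
  Koenig's theorem, for the bipartite graph whose edges are the elements \<open>v\<close> of \<open>V\<close>, with ends \<open>f v\<close>
  and \<open>g v\<close>. It is an instance of the previous theorem in which elements conflict if they agree
  under \<open>g\<close>: a set of edges with distinct \<open>g\<close>-ends is dominated by no fewer edges than it has. If \<open>N\<close>
  is the neighbourhood of \<open>I \<subseteq> A\<close>, then \<open>A - I\<close> and \<open>N\<close> form a cover, so minimality of \<open>t\<close> bounds the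
  size of \<open>N\<close> from below.
\<close>

lemma koenig:
  fixes V :: "'a set" and f :: "'a \<Rightarrow> 'b" and g :: "'a \<Rightarrow> 'c"
  assumes "finite V"
  obtains M X Y where "M \<subseteq> V" "inj_on f M" "inj_on g M" "finite X" "finite Y"
    "\<And>v. v \<in> V \<Longrightarrow> f v \<in> X \<or> g v \<in> Y" "card X + card Y \<le> card M"
proof -
  define cover where "cover X Y t \<longleftrightarrow> finite X \<and> finite Y \<and>
      (\<forall>v\<in>V. f v \<in> X \<or> g v \<in> Y) \<and> card X + card Y = t" for X Y t
  define t where "t = (LEAST t. \<exists>X Y. cover X Y t)"
  define A where "A = f ` V"
  have finA: "finite A" using assms by (simp add: A_def)
  have covA: "cover A {} (card A)" using finA by (auto simp: cover_def A_def)
  have "\<exists>t X Y. cover X Y t" using covA by blast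
  then have "\<exists>X Y. cover X Y t" unfolding t_def by (rule LeastI_ex)
  then obtain X Y where XY: "cover X Y t" by blast
  have least: "t \<le> t'" if "cover X' Y' t'" for X' Y' t'
    unfolding t_def using that by (intro Least_le) blast
  have und: "\<exists>S. undominated (\<lambda>x y. g x \<noteq> g y) {v \<in> V. f v \<in> I} (card I - (card A - t)) S"
    if I: "I \<subseteq> A" for I
  proof -
    define N where "N = g ` {v \<in> V. f v \<in> I}"
    define r where "r = inv_into {v \<in> V. f v \<in> I} g"
    have r1: "r n \<in> {v \<in> V. f v \<in> I}" if "n \<in> N" for n
      using that unfolding r_def N_def by (rule inv_into_into)
    have r2: "g (r n) = n" if "n \<in> N" for n
      using that unfolding r_def N_def by (rule f_inv_into_f)
    have finI: "finite I" using I finA finite_subset by blast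
    have "cover (A - I) N (card (A - I) + card N)"
      using assms finA by (auto simp: cover_def A_def N_def)
    from least[OF this] have N: "card I - (card A - t) \<le> card N"
      using I finI card_mono[OF finA I] by (simp add: card_Diff_subset)
    have "undominated (\<lambda>x y. g x \<noteq> g y) {v \<in> V. f v \<in> I} (card I - (card A - t)) (r ` N)"
      unfolding undominated_def
    proof (intro conjI allI impI)
      fix \<sigma> assume \<sigma>: "\<sigma> \<subseteq> {v \<in> V. f v \<in> I}" "card \<sigma> < card I - (card A - t)"
      have "finite \<sigma>" by (rule finite_subset[OF \<sigma>(1)]) (use assms in simp)
      then have "card (g ` \<sigma>) < card N" using card_image_le[of \<sigma> g] \<sigma>(2) N by simp
      moreover have "finite (g ` \<sigma>)" using \<open>finite \<sigma>\<close> by simp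
      ultimately have "\<not> N \<subseteq> g ` \<sigma>" using card_mono leD by blast
      then obtain n where "n \<in> N" "n \<notin> g ` \<sigma>" by blast
      then have "r n \<in> r ` N" "\<forall>x\<in>\<sigma>. g x \<noteq> g (r n)" using r2[of n] by auto
      then show "\<exists>s\<in>r ` N. \<forall>x\<in>\<sigma>. x \<noteq> s \<longrightarrow> g x \<noteq> g s" by blast
    next
      show "r ` N \<subseteq> {v \<in> V. f v \<in> I}" using r1 by blast
    next
      show "pairwise (\<lambda>x y. g x \<noteq> g y) (r ` N)" using r2 by (auto simp: pairwise_def)
    qed
    then show ?thesis by blast
  qed
  have tA: "t \<le> card A" using least[OF covA] .
  show thesis
  proof (rule hall_partial_transversal[of V A "\<lambda>x y. g x \<noteq> g y" f "card A - t"])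
    show "symp (\<lambda>x y. g x \<noteq> g y)" by (auto simp: symp_def)
    fix M
    assume M: "M \<subseteq> V" "pairwise (\<lambda>x y. g x \<noteq> g y) M" "inj_on f M"
      "card A \<le> card M + (card A - t)"
    show thesis
    proof (rule that[of M X Y])
      show "inj_on g M" using M(2) by (auto simp: inj_on_def pairwise_def)
      show "card X + card Y \<le> card M" using M(4) XY tA by (simp add: cover_def)
    qed (use M XY in \<open>auto simp: cover_def\<close>)
  qed (fact assms, fact finA, rule und)
qed

text \<open>
  Aharoni's theorem that a tripartite 3-uniform hypergraph has cover number at most twice its
  matching number; the elements \<open>v\<close> of \<open>V\<close> are the hyperedges, with vertices \<open>f v\<close>, \<open>g v\<close>, \<open>h v\<close>. For a
  set \<open>I\<close> of first vertices, a cover of the bipartite graph formed by the hyperedges through \<open>I\<close>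
  becomes a cover of the hypergraph when the first vertices outside \<open>I\<close> are added. By Koenig's
  theorem that bipartite graph thus has a matching \<open>M\<close> of size at least \<open>t - card (A - I)\<close>. A
  hyperedge meets at most two edges of \<open>M\<close>, so at least half as many hyperedges are needed to
  dominate \<open>M\<close>. This is what the theorem on partial transversals needs to produce a matching of
  size \<open>t / 2\<close>, rounded up.
\<close>

theorem tripartite_cover:
  fixes V :: "'a set" and f :: "'a \<Rightarrow> 'b" and g :: "'a \<Rightarrow> 'c" and h :: "'a \<Rightarrow> 'd"
  assumes "finite V"
  obtains M X Y Z where "M \<subseteq> V" "inj_on f M" "inj_on g M" "inj_on h M"
    "finite X" "finite Y" "finite Z" "\<And>v. v \<in> V \<Longrightarrow> f v \<in> X \<or> g v \<in> Y \<or> h v \<in> Z"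
    "card X + card Y + card Z \<le> 2 * card M"
proof -
  define cover where "cover X Y Z t \<longleftrightarrow> finite X \<and> finite Y \<and> finite Z \<and>
      (\<forall>v\<in>V. f v \<in> X \<or> g v \<in> Y \<or> h v \<in> Z) \<and> card X + card Y + card Z = t" for X Y Z t
  define t where "t = (LEAST t. \<exists>X Y Z. cover X Y Z t)"
  define A where "A = f ` V"
  \<comment> \<open>the size aimed at for the matching: half of \<open>t\<close>, rounded up\<close>
  define k where "k = (t + 1) div 2"
  define apart where "apart x y \<longleftrightarrow> g x \<noteq> g y \<and> h x \<noteq> h y" for x y
  have finA: "finite A" using assms by (simp add: A_def)
  have covA: "cover A {} {} (card A)" using finA by (auto simp: cover_def A_def)
  have "\<exists>t X Y Z. cover X Y Z t" using covA by blast
  then have "\<exists>X Y Z. cover X Y Z t" unfolding t_def by (rule LeastI_ex)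
  then obtain X Y Z where XYZ: "cover X Y Z t" by blast
  have least: "t \<le> t'" if "cover X' Y' Z' t'" for X' Y' Z' t'
    unfolding t_def using that by (intro Least_le) blast
  have tA: "t \<le> card A" using least[OF covA] .
  have und: "\<exists>S. undominated apart {v \<in> V. f v \<in> I} (card I - (card A - k)) S" if I: "I \<subseteq> A" for I
  proof -
    have finI: "finite I" using I finA finite_subset by blast
    obtain M Y' Z' where M: "M \<subseteq> {v \<in> V. f v \<in> I}" "inj_on g M" "inj_on h M"
      and YZ: "finite Y'" "finite Z'" "\<And>v. v \<in> {v \<in> V. f v \<in> I} \<Longrightarrow> g v \<in> Y' \<or> h v \<in> Z'"
        "card Y' + card Z' \<le> card M"
      by (rule koenig[of "{v \<in> V. f v \<in> I}" g h]) (use assms in auto)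
    have "cover (A - I) Y' Z' (card (A - I) + card Y' + card Z')"
      using assms finA YZ by (auto simp: cover_def A_def)
    from least[OF this] have M_large: "t + card I \<le> card A + card M"
      using YZ(4) I finI card_mono[OF finA I] by (simp add: card_Diff_subset)
    have "undominated apart {v \<in> V. f v \<in> I} (card I - (card A - k)) M"
      unfolding undominated_def
    proof (intro conjI allI impI)
      show "M \<subseteq> {v \<in> V. f v \<in> I}" by (rule M(1))
      show "pairwise apart M"
        using M(2,3) by (auto simp: pairwise_def apart_def inj_on_def)
      fix \<sigma> assume \<sigma>: "\<sigma> \<subseteq> {v \<in> V. f v \<in> I}" "card \<sigma> < card I - (card A - k)"
      have fin: "finite \<sigma>" by (rule finite_subset[OF \<sigma>(1)]) (use assms in simp)
      show "\<exists>s\<in>M. \<forall>x\<in>\<sigma>. x \<noteq> s \<longrightarrow> apart x s"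
      proof (rule ccontr)
        assume "\<not> ?thesis"
        then have "g s \<in> g ` \<sigma> \<or> h s \<in> h ` \<sigma>" if "s \<in> M" for s
          using that unfolding apart_def by (metis imageI)
        then have "M \<subseteq> {s \<in> M. g s \<in> g ` \<sigma>} \<union> {s \<in> M. h s \<in> h ` \<sigma>}" by blast
        moreover have finM: "finite M" by (rule finite_subset[OF M(1)]) (use assms in simp)
        ultimately have "card M \<le> card {s \<in> M. g s \<in> g ` \<sigma>} + card {s \<in> M. h s \<in> h ` \<sigma>}"
          by (intro order_trans[OF card_mono card_Un_le]) auto
        also have "card {s \<in> M. g s \<in> g ` \<sigma>} \<le> card (g ` \<sigma>)"
          by (rule card_inj_on_le[of g]) (use M(2) fin in \<open>auto intro: inj_on_subset\<close>)
        also have "card (g ` \<sigma>) \<le> card \<sigma>" by (rule card_image_le[OF fin])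
        also have "card {s \<in> M. h s \<in> h ` \<sigma>} \<le> card (h ` \<sigma>)"
          by (rule card_inj_on_le[of h]) (use M(3) fin in \<open>auto intro: inj_on_subset\<close>)
        also have "card (h ` \<sigma>) \<le> card \<sigma>" by (rule card_image_le[OF fin])
        finally have "card M \<le> card \<sigma> + card \<sigma>" by simp
        then show False
          using \<sigma>(2) M_large card_mono[OF finA I] tA unfolding k_def by linarith
      qed
    qed
    then show ?thesis by blast
  qed
  show thesis
  proof (rule hall_partial_transversal[of V A apart f "card A - k"])
    show "symp apart" by (auto simp: symp_def apart_def)
    fix M
    assume M: "M \<subseteq> V" "pairwise apart M" "inj_on f M" "card A \<le> card M + (card A - k)"
    show thesis
    proof (rule that[of M X Y Z])
      show "inj_on g M" "inj_on h M" using M(2) by (auto simp: inj_on_def pairwise_def apart_def)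
      have "k \<le> card A" using tA by (simp add: k_def)
      then show "card X + card Y + card Z \<le> 2 * card M"
        using M(4) XYZ by (simp add: cover_def k_def)
    qed (use M XYZ in \<open>auto simp: cover_def\<close>)
  qed (fact assms, fact finA, rule und)
qed

section \<open>Covering by balls\<close>

text \<open>
  Whether a few balls cover \<open>U\<close> is decided on a subset whose size depends only on the number of balls.
  If \<open>v \<in> U\<close> is contained in a set \<open>C\<close> of the family \<open>\<C>\<close>, then \<open>C\<close> lies in one of the \<open>card J\<close> balls
  around \<open>v\<close>. So one collects \<open>v\<close> and, for each of these balls, recursively an obstruction to
  covering the part of \<open>U\<close> outside it with one set fewer.
\<close>

lemma balls_or_obstruction:
  fixes ball :: "'i \<Rightarrow> 'a \<Rightarrow> 'a set"
  assumes "finite J"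
  shows "(\<exists>\<B> \<subseteq> J \<times> U. finite \<B> \<and> card \<B> \<le> t \<and> U \<subseteq> (\<Union>(i, v)\<in>\<B>. ball i v)) \<or>
    (\<exists>S \<subseteq> U. finite S \<and> card S \<le> (\<Sum>k\<le>t. card J ^ k) \<and>
      (\<forall>\<C>. finite \<C> \<and> card \<C> \<le> t \<and> (\<forall>C\<in>\<C>. \<exists>i\<in>J. \<forall>v\<in>C. C \<subseteq> ball i v) \<longrightarrow> \<not> S \<subseteq> \<Union>\<C>))"
proof (induction t arbitrary: U)
  case 0
  show ?case
  proof (cases "U = {}")
    case True
    then show ?thesis by (intro disjI1 exI[of _ "{}"]) auto
  next
    case False
    then obtain u where "u \<in> U" by blast
    then show ?thesis by (intro disjI2 exI[of _ "{u}"]) auto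
  qed
next
  case (Suc t)
  define covered where "covered W n \<longleftrightarrow>
    (\<exists>\<B> \<subseteq> J \<times> W. finite \<B> \<and> card \<B> \<le> n \<and> W \<subseteq> (\<Union>(i, v)\<in>\<B>. ball i v))" for W n
  define obstructs where "obstructs S n \<longleftrightarrow>
    (\<forall>\<C>. finite \<C> \<and> card \<C> \<le> n \<and> (\<forall>C\<in>\<C>. \<exists>i\<in>J. \<forall>v\<in>C. C \<subseteq> ball i v) \<longrightarrow> \<not> S \<subseteq> \<Union>\<C>)" for S n
  note IH = Suc.IH[folded covered_def obstructs_def]
  have "covered U (Suc t) \<or>
    (\<exists>S \<subseteq> U. finite S \<and> card S \<le> (\<Sum>k\<le>Suc t. card J ^ k) \<and> obstructs S (Suc t))"
  proof (cases "U = {} \<or> (\<exists>v\<in>U. \<exists>i\<in>J. covered (U - ball i v) t)")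
    case True
    then show ?thesis
    proof
      assume "U = {}"
      then have "covered U (Suc t)" unfolding covered_def by (intro exI[of _ "{}"]) auto
      then show ?thesis ..
    next
      assume "\<exists>v\<in>U. \<exists>i\<in>J. covered (U - ball i v) t"
      then obtain v i \<B> where v: "v \<in> U" "i \<in> J" and \<B>: "\<B> \<subseteq> J \<times> (U - ball i v)" "finite \<B>"
        "card \<B> \<le> t" "U - ball i v \<subseteq> (\<Union>(i, v)\<in>\<B>. ball i v)"
        unfolding covered_def by blast
      have "card (insert (i, v) \<B>) \<le> Suc t"
        using \<B>(2,3) card_insert_le_m1[of "Suc t" \<B>] by simp
      moreover have "insert (i, v) \<B> \<subseteq> J \<times> U" using v \<B>(1) by blast
      moreover have "U \<subseteq> (\<Union>(i, v)\<in>insert (i, v) \<B>. ball i v)" using \<B>(4) by auto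
      ultimately have "covered U (Suc t)"
        unfolding covered_def using \<B>(2) by (meson finite.insertI)
      then show ?thesis ..
    qed
  next
    case False
    then obtain v where v: "v \<in> U" by blast
    define good where "good i S \<longleftrightarrow> S \<subseteq> U - ball i v \<and> finite S \<and>
      card S \<le> (\<Sum>k\<le>t. card J ^ k) \<and> obstructs S t" for i S
    have "\<exists>S. good i S" if "i \<in> J" for i
      using IH[of "U - ball i v"] False v that unfolding good_def by blast
    then have "\<forall>i\<in>J. \<exists>S. good i S" by simp
    from bchoice[OF this] obtain S where good: "\<forall>i\<in>J. good i (S i)" ..
    have S: "S i \<subseteq> U - ball i v" "finite (S i)" "card (S i) \<le> (\<Sum>k\<le>t. card J ^ k)"
      "obstructs (S i) t" if "i \<in> J" for i
      using bspec[OF good that] by (simp_all add: good_def)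
    define S' where "S' = insert v (\<Union>i\<in>J. S i)"
    have "card S' \<le> Suc (card (\<Union>i\<in>J. S i))" unfolding S'_def by (rule card_insert_le_m1) auto
    moreover have "card (\<Union>i\<in>J. S i) \<le> (\<Sum>i\<in>J. card (S i))" by (rule card_UN_le[OF assms])
    moreover have "(\<Sum>i\<in>J. card (S i)) \<le> (\<Sum>i\<in>J. \<Sum>k\<le>t. card J ^ k)"
      by (rule sum_mono) (rule S(3))
    moreover have "Suc (\<Sum>i\<in>J. \<Sum>k\<le>t. card J ^ k) = (\<Sum>k\<le>Suc t. card J ^ k)"
      by (simp add: sum.atMost_Suc_shift sum_distrib_left del: sum.atMost_Suc)
    ultimately have card: "card S' \<le> (\<Sum>k\<le>Suc t. card J ^ k)" by linarith
    have "obstructs S' (Suc t)"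
      unfolding obstructs_def
    proof (intro allI impI notI, elim conjE)
      fix \<C>
      assume \<C>: "finite \<C>" "card \<C> \<le> Suc t" "\<forall>C\<in>\<C>. \<exists>i\<in>J. \<forall>v\<in>C. C \<subseteq> ball i v"
        and cov: "S' \<subseteq> \<Union>\<C>"
      have "v \<in> S'" by (simp add: S'_def)
      then obtain C where C: "C \<in> \<C>" "v \<in> C" using cov by blast
      from bspec[OF \<C>(3) C(1)] obtain i where i: "i \<in> J" "\<forall>v\<in>C. C \<subseteq> ball i v" ..
      have "S i \<subseteq> S'" using i(1) unfolding S'_def by blast
      moreover have "S i \<inter> C = {}" using S(1)[OF i(1)] bspec[OF i(2) C(2)] by blast
      ultimately have "S i \<subseteq> \<Union>(\<C> - {C})" using cov by blast
      moreover have "finite (\<C> - {C})" "card (\<C> - {C}) \<le> t" using \<C>(1,2) C(1) by simp_all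
      moreover have "\<forall>C\<in>\<C> - {C}. \<exists>i\<in>J. \<forall>v\<in>C. C \<subseteq> ball i v" using \<C>(3) by simp
      ultimately show False
        using S(4)[OF i(1), unfolded obstructs_def, THEN spec, of "\<C> - {C}"] by simp
    qed
    moreover have "S' \<subseteq> U" using S(1) v unfolding S'_def by blast
    moreover have "finite S'" unfolding S'_def using S(2) assms by simp
    ultimately show ?thesis by (intro disjI2 exI[of _ S'] conjI card)
  qed
  then show ?case unfolding covered_def obstructs_def .
qed

lemma sym_rtrancl_class_eq:
  assumes "sym E" "(u, v) \<in> E"
  shows "E\<^sup>* `` {u} = E\<^sup>* `` {v}"
proof -
  have "(v, u) \<in> E" using assms by (auto dest: symD)
  then show ?thesis using assms(2) by (auto intro: converse_rtrancl_into_rtrancl)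
qed

text \<open>
  The tripartite theorem is applied with each vertex regarded as a hyperedge, joining its three
  monochromatic components. Adjacent vertices share a component, so a matching is an independent
  set of vertices, and a cover is a set of components.
\<close>

lemma component_cover:
  fixes E :: "nat \<Rightarrow> 'a rel"
  assumes "finite S" "\<And>i. sym (E i)"
  obtains M \<C> where "M \<subseteq> S" "\<And>i u v. i < 3 \<Longrightarrow> u \<in> M \<Longrightarrow> v \<in> M \<Longrightarrow> (u, v) \<in> E i \<Longrightarrow> u = v"
    "finite \<C>" "card \<C> \<le> 2 * card M" "S \<subseteq> \<Union>\<C>"
    "\<And>C. C \<in> \<C> \<Longrightarrow> \<exists>i<3. \<forall>u\<in>C. \<forall>v\<in>C. (u, v) \<in> (E i)\<^sup>*"
proof -
  define cl where "cl i v = (E i)\<^sup>* `` {v}" for i v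
  show thesis
  proof (rule tripartite_cover[OF assms(1), of "cl 0" "cl 1" "cl 2"])
    fix M X Y Z
    assume M: "M \<subseteq> S" "inj_on (cl 0) M" "inj_on (cl 1) M" "inj_on (cl 2) M"
      and fin: "finite X" "finite Y" "finite Z"
      and cov: "\<And>v. v \<in> S \<Longrightarrow> cl 0 v \<in> X \<or> cl 1 v \<in> Y \<or> cl 2 v \<in> Z"
      and card: "card X + card Y + card Z \<le> 2 * card M"
    \<comment> \<open>\<open>X\<close>, \<open>Y\<close>, \<open>Z\<close> may contain sets that are no components; these are discarded.\<close>
    define \<C> where "\<C> = (X \<inter> range (cl 0)) \<union> (Y \<inter> range (cl 1)) \<union> (Z \<inter> range (cl 2))"
    have inj: "inj_on (cl i) M" if "i < 3" for i
    proof -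
      have "i = 0 \<or> i = 1 \<or> i = 2" using that by linarith
      then show ?thesis using M by blast
    qed
    have "card \<C> \<le> card (X \<inter> range (cl 0)) + card (Y \<inter> range (cl 1)) + card (Z \<inter> range (cl 2))"
      unfolding \<C>_def
      using card_Un_le[of "X \<inter> range (cl 0) \<union> Y \<inter> range (cl 1)" "Z \<inter> range (cl 2)"]
        card_Un_le[of "X \<inter> range (cl 0)" "Y \<inter> range (cl 1)"] by linarith
    also have "\<dots> \<le> card X + card Y + card Z"
      using fin by (intro add_mono card_mono) auto
    also note card
    finally have card\<C>: "card \<C> \<le> 2 * card M" .
    have mem: "v \<in> cl i v" for i v by (simp add: cl_def)
    have cov\<C>: "S \<subseteq> \<Union>\<C>"
    proof
      fix v assume "v \<in> S"
      from cov[OF this] have "\<exists>i. cl i v \<in> \<C>" unfolding \<C>_def by blast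
      then show "v \<in> \<Union>\<C>" using mem by blast
    qed
    have mono: "\<exists>i<3. \<forall>u\<in>C. \<forall>v\<in>C. (u, v) \<in> (E i)\<^sup>*" if "C \<in> \<C>" for C
    proof -
      have "\<exists>i\<in>{0, 1, 2}. C \<in> range (cl i)"
        using that unfolding \<C>_def by blast
      then obtain i x where i: "i \<in> {0, 1, 2}" "C = cl i x" by blast
      have "(u, v) \<in> (E i)\<^sup>*" if "u \<in> C" "v \<in> C" for u v
      proof -
        have "(x, u) \<in> (E i)\<^sup>*" "(x, v) \<in> (E i)\<^sup>*" using that i by (auto simp: cl_def)
        moreover from this(1) have "(u, x) \<in> (E i)\<^sup>*"
          by (rule symD[OF sym_rtrancl[OF assms(2)]])
        ultimately show ?thesis by (blast intro: rtrancl_trans)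
      qed
      moreover have "i < 3" using i(1) by auto
      ultimately show ?thesis by blast
    qed
    have indep: "u = v" if "i < 3" "u \<in> M" "v \<in> M" "(u, v) \<in> E i" for i u v
    proof (rule inj_onD[OF inj[OF that(1)] _ that(2,3)])
      show "cl i u = cl i v" unfolding cl_def by (rule sym_rtrancl_class_eq[OF assms(2) that(4)])
    qed
    have fin\<C>: "finite \<C>" using fin by (simp add: \<C>_def)
    show thesis by (rule that[OF M(1) indep fin\<C> card\<C> cov\<C> mono])
  qed
qed

definition rel_ball :: "'a rel \<Rightarrow> nat \<Rightarrow> 'a \<Rightarrow> 'a set" where
  "rel_ball E r v = {u. \<exists>m\<le>r. (v, u) \<in> E ^^ m}"

lemma relpow_subset_mono:
  fixes R R' :: "'a rel"
  assumes "R \<subseteq> R'"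
  shows "R ^^ m \<subseteq> R' ^^ m"
proof (induction m)
  case (Suc m)
  then show ?case unfolding relpow.simps using assms by (rule relcomp_mono)
qed simp

text \<open>
  A shortest walk repeats no arc, and \<open>n ^ 2\<close> is an upper bound for the number of arcs on \<open>S\<close>.
\<close>

lemma rtrancl_imp_rel_ball:
  assumes "(u, v) \<in> (E \<inter> S \<times> S)\<^sup>*" "finite S" "card S \<le> n"
  shows "v \<in> rel_ball E (n ^ 2) u"
proof -
  have fin: "finite (E \<inter> S \<times> S)" using assms(2) by simp
  have "card (E \<inter> S \<times> S) \<le> card (S \<times> S)" using assms(2) by (intro card_mono) auto
  also have "\<dots> = card S ^ 2" by (simp add: card_cartesian_product power2_eq_square)
  also have "\<dots> \<le> n ^ 2" using assms(3) by (rule power_mono) simp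
  finally have card: "card (E \<inter> S \<times> S) \<le> n ^ 2" .
  from assms(1) obtain m where m: "m \<le> card (E \<inter> S \<times> S)" "(u, v) \<in> (E \<inter> S \<times> S) ^^ m"
    unfolding rtrancl_finite_eq_relpow[OF fin] by (elim UN_E) simp
  have "(E \<inter> S \<times> S) ^^ m \<subseteq> E ^^ m" by (rule relpow_subset_mono) simp
  then have "(u, v) \<in> E ^^ m" using m(2) by (rule subsetD)
  then show ?thesis using m(1) card unfolding rel_ball_def by (auto intro: exI[of _ m])
qed

text \<open>
  The two halves meet here. If no \<open>2 * \<alpha>\<close> balls of radius \<open>r\<close> cover \<open>V\<close>, there is an obstructing set
  \<open>S\<close> with at most \<open>n = (\<Sum>k\<le>2 * \<alpha>. 3 ^ k)\<close> vertices. The graph induced on \<open>S\<close> is covered by \<open>2 * \<alpha>\<close>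
  monochromatic components of its own. These are so small that each lies in the ball of
  radius \<open>r = n ^ 2\<close> around any of its points, a contradiction.
\<close>

theorem ball_cover:
  fixes E :: "nat \<Rightarrow> 'a rel"
  assumes sym: "\<And>i. sym (E i)"
    and indep: "\<And>M. M \<subseteq> V \<Longrightarrow> finite M \<Longrightarrow>
      (\<And>i u v. i < 3 \<Longrightarrow> u \<in> M \<Longrightarrow> v \<in> M \<Longrightarrow> (u, v) \<in> E i \<Longrightarrow> u = v) \<Longrightarrow> card M \<le> \<alpha>"
  defines "r \<equiv> (\<Sum>k\<le>2 * \<alpha>. 3 ^ k) ^ 2"
  obtains \<B> where "\<B> \<subseteq> {..<3} \<times> V" "finite \<B>" "card \<B> \<le> 2 * \<alpha>"
    "V \<subseteq> (\<Union>(i, v)\<in>\<B>. rel_ball (E i) r v)"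
proof (rule ccontr)
  assume "\<not> thesis"
  then have "\<not> (\<exists>\<B> \<subseteq> {..<3} \<times> V. finite \<B> \<and> card \<B> \<le> 2 * \<alpha> \<and>
      V \<subseteq> (\<Union>(i, v)\<in>\<B>. rel_ball (E i) r v))"
    using that by blast
  then have "\<exists>S \<subseteq> V. finite S \<and> card S \<le> (\<Sum>k\<le>2 * \<alpha>. 3 ^ k) \<and>
    (\<forall>\<C>. finite \<C> \<and> card \<C> \<le> 2 * \<alpha> \<and>
      (\<forall>C\<in>\<C>. \<exists>i\<in>{..<3}. \<forall>v\<in>C. C \<subseteq> rel_ball (E i) r v) \<longrightarrow> \<not> S \<subseteq> \<Union>\<C>)"
    using balls_or_obstruction[of "{..<3::nat}" V "2 * \<alpha>" "\<lambda>i. rel_ball (E i) r",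
        unfolded card_lessThan] by (simp only: finite_lessThan simp_thms)
  then obtain S where S: "S \<subseteq> V" "finite S" "card S \<le> (\<Sum>k\<le>2 * \<alpha>. 3 ^ k)"
    and obs: "\<forall>\<C>. finite \<C> \<and> card \<C> \<le> 2 * \<alpha> \<and>
      (\<forall>C\<in>\<C>. \<exists>i\<in>{..<3}. \<forall>v\<in>C. C \<subseteq> rel_ball (E i) r v) \<longrightarrow> \<not> S \<subseteq> \<Union>\<C>"
    by (elim exE conjE)
  show False
  proof (rule component_cover[OF S(2), of "\<lambda>i. E i \<inter> S \<times> S"])
    show "sym (E i \<inter> S \<times> S)" for i
      using sym[of i] by (auto simp: sym_def)
    fix M \<C>
    assume M: "M \<subseteq> S" "\<And>i u v. i < 3 \<Longrightarrow> u \<in> M \<Longrightarrow> v \<in> M \<Longrightarrow> (u, v) \<in> E i \<inter> S \<times> S \<Longrightarrow> u = v"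
      and \<C>: "finite \<C>" "card \<C> \<le> 2 * card M" "S \<subseteq> \<Union>\<C>"
        "\<And>C. C \<in> \<C> \<Longrightarrow> \<exists>i<3. \<forall>u\<in>C. \<forall>v\<in>C. (u, v) \<in> (E i \<inter> S \<times> S)\<^sup>*"
    have "card M \<le> \<alpha>"
    proof (rule indep)
      show "u = v" if "i < 3" "u \<in> M" "v \<in> M" "(u, v) \<in> E i" for i u v
        using M(1) that by (intro M(2)[of i u v]) auto
      show "M \<subseteq> V" using M(1) S(1) by blast
      show "finite M" using M(1) S(2) by (rule finite_subset)
    qed
    moreover have "\<exists>i\<in>{..<3}. \<forall>v\<in>C. C \<subseteq> rel_ball (E i) r v" if "C \<in> \<C>" for C
    proof -
      from \<C>(4)[OF that] obtain i where i: "i < 3"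
        "\<forall>u\<in>C. \<forall>v\<in>C. (u, v) \<in> (E i \<inter> S \<times> S)\<^sup>*" by (elim exE conjE)
      have "C \<subseteq> rel_ball (E i) r u" if "u \<in> C" for u
      proof
        fix v assume "v \<in> C"
        then have "(u, v) \<in> (E i \<inter> S \<times> S)\<^sup>*" using i(2) that by blast
        then show "v \<in> rel_ball (E i) r u"
          unfolding r_def by (rule rtrancl_imp_rel_ball[OF _ S(2,3)])
      qed
      then show ?thesis using i(1) by (intro bexI[of _ i]) auto
    qed
    moreover have "card \<C> \<le> 2 * \<alpha>" using \<C>(2) \<open>card M \<le> \<alpha>\<close> by linarith
    ultimately show False using spec[OF obs, of \<C>] \<C>(1,3) by simp
  qed
qed

section \<open>Balls as subgraphs\<close>

text \<open>
  All arcs of the colour class \<open>E\<close> between points of the ball are kept, arcs of other colours are not.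
\<close>

definition ball_graph :: "'a rel \<Rightarrow> nat \<Rightarrow> 'a \<Rightarrow> 'a pair_pre_digraph" where
  "ball_graph E r v = \<lparr>pverts = rel_ball E r v, parcs = E \<inter> rel_ball E r v \<times> rel_ball E r v\<rparr>"

lemma (in pair_wf_digraph) relpow_imp_awalk:
  assumes "(u, v) \<in> parcs G ^^ m" "u \<in> pverts G"
  shows "\<exists>p. awalk u p v \<and> length p = m"
  using assms
proof (induction m arbitrary: u)
  case 0
  then show ?case by (intro exI[of _ "[]"]) (simp add: awalk_Nil_iff)
next
  case (Suc m)
  from relpow_Suc_D2[OF Suc.prems(1)] obtain x where x: "(u, x) \<in> parcs G" "(x, v) \<in> parcs G ^^ m"
    by blast
  then obtain p where "awalk x p v" "length p = m" using Suc.IH in_arcsD2 by blast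
  then show ?case using x(1) by (intro exI[of _ "(u, x) # p"]) (simp add: awalk_Cons_iff)
qed

lemma distance_le_of_relpow:
  assumes "pair_wf_digraph H" "(u, v) \<in> parcs H ^^ m" "u \<in> pverts H"
  shows "distance H u v \<le> ereal (real m)"
proof -
  interpret pair_wf_digraph H by fact
  obtain p where p: "awalk u p v" "length p = m" using relpow_imp_awalk[OF assms(2,3)] by blast
  have "awalk_cost (\<lambda>_. 1) p = real (length p)" by (induction p) simp_all
  then show ?thesis
    using min_cost_le_walk_cost[OF p(1), of "\<lambda>_. 1"] p(2) by (simp add: distance_def)
qed

lemma relpow_converse_sym:
  assumes "sym E" "(u, v) \<in> E ^^ m"
  shows "(v, u) \<in> E ^^ m"
  using assms(2)
proof (induction m arbitrary: v)
  case (Suc m)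
  from relpow_Suc_E[OF Suc.prems] obtain x where "(u, x) \<in> E ^^ m" "(x, v) \<in> E" by blast
  then show ?case using Suc.IH symD[OF assms(1)] by (blast intro: relpow_Suc_I2)
qed simp

text \<open>
  A walk of length at most \<open>r\<close> from the centre stays in the ball, since its initial segments are short
  as well.
\<close>

lemma ball_graph_radius:
  assumes "(v, u) \<in> E ^^ m" "m \<le> r"
  shows "(v, u) \<in> parcs (ball_graph E r v) ^^ m"
  using assms
proof (induction m arbitrary: u)
  case (Suc m)
  from relpow_Suc_E[OF Suc.prems(1)] obtain x where x: "(v, x) \<in> E ^^ m" "(x, u) \<in> E" by blast
  have "x \<in> rel_ball E r v" "u \<in> rel_ball E r v"
    using x(1) Suc.prems unfolding rel_ball_def by (auto intro: exI[of _ m] exI[of _ "Suc m"] simp del: relpow.simps)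
  then have "(x, u) \<in> parcs (ball_graph E r v)" using x(2) by (simp add: ball_graph_def)
  then show ?case using Suc.IH[OF x(1)] Suc.prems(2) by (auto intro: relpow_Suc_I)
qed simp

lemma centre_in_rel_ball: "v \<in> rel_ball E r v"
  unfolding rel_ball_def by (auto intro: exI[of _ 0])

lemma rel_ball_subset:
  assumes "E \<subseteq> V \<times> V" "v \<in> V"
  shows "rel_ball E r v \<subseteq> V"
proof
  fix u assume "u \<in> rel_ball E r v"
  then obtain m where m: "(v, u) \<in> E ^^ m" by (auto simp: rel_ball_def)
  show "u \<in> V"
  proof (cases m)
    case (Suc n)
    then show ?thesis using m assms(1) by (auto elim: relpow_Suc_E)
  qed (use m assms(2) in simp)
qed

lemma ball_graph_pair_graph:
  assumes "finite V" "E \<subseteq> V \<times> V" "sym E" "irrefl E" "v \<in> V"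
  shows "pair_graph (ball_graph E r v)"
proof -
  have "finite (rel_ball E r v)"
    using rel_ball_subset[OF assms(2,5)] assms(1) by (rule finite_subset)
  then show ?thesis
    using assms(3,4)
    by unfold_locales (auto simp: ball_graph_def symmetric_def irrefl_def intro!: symI dest: symD)
qed

lemma ball_graph_relpow:
  assumes "sym E" "x \<in> rel_ball E r v" "y \<in> rel_ball E r v"
  obtains m where "m \<le> 2 * r" "(x, y) \<in> parcs (ball_graph E r v) ^^ m"
proof -
  obtain k l where k: "k \<le> r" "(v, x) \<in> E ^^ k" and l: "l \<le> r" "(v, y) \<in> E ^^ l"
    using assms(2,3) by (auto simp: rel_ball_def)
  have "sym (parcs (ball_graph E r v))"
    using assms(1) by (auto simp: ball_graph_def sym_def)
  then have "(x, v) \<in> parcs (ball_graph E r v) ^^ k"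
    using ball_graph_radius[OF k(2,1)] by (rule relpow_converse_sym)
  then have "(x, y) \<in> parcs (ball_graph E r v) ^^ (k + l)"
    using ball_graph_radius[OF l(2,1)] by (rule relpow_trans)
  then show thesis using k(1) l(1) by (intro that[of "k + l"]) simp_all
qed

lemma diameter_ball_graph_le:
  assumes "finite V" "E \<subseteq> V \<times> V" "sym E" "irrefl E" "v \<in> V"
  shows "diameter (ball_graph E r v) \<le> ereal (real (2 * r))"
proof -
  define H where "H = ball_graph E r v"
  define D where "D = {distance H x y | x y. x \<in> pverts H \<and> y \<in> pverts H}"
  interpret pair_graph H unfolding H_def by (rule ball_graph_pair_graph[OF assms])
  have verts: "pverts H = rel_ball E r v" by (simp add: H_def ball_graph_def)
  have "D = (\<lambda>(x, y). distance H x y) ` (pverts H \<times> pverts H)" by (auto simp: D_def)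
  then have "finite D" using pair_finite_verts by simp
  moreover have "D \<noteq> {}" using centre_in_rel_ball[of v E r] verts by (auto simp: D_def)
  ultimately have "Max D \<in> D" by (rule Max_in)
  then obtain x y where xy: "Max D = distance H x y" "x \<in> pverts H" "y \<in> pverts H"
    by (auto simp: D_def)
  obtain m where m: "m \<le> 2 * r" "(x, y) \<in> parcs H ^^ m"
    unfolding H_def using ball_graph_relpow[OF assms(3), of x r v y] xy(2,3) verts by blast
  have "distance H x y \<le> ereal (real m)"
    by (rule distance_le_of_relpow[OF pair_wf_digraph m(2) xy(2)])
  also have "\<dots> \<le> ereal (real (2 * r))" using m(1) by simp
  finally show ?thesis using xy(1) by (simp add: diameter_def D_def H_def)
qed

lemma connected_ball_graph:
  assumes "finite V" "E \<subseteq> V \<times> V" "sym E" "irrefl E" "v \<in> V"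
  shows "Digraph_Component.connected (with_proj (ball_graph E r v))"
proof -
  interpret pair_graph "ball_graph E r v" by (rule ball_graph_pair_graph[OF assms])
  have verts: "pverts (ball_graph E r v) = rel_ball E r v" by (simp add: ball_graph_def)
  have reach: "reachable (with_proj (ball_graph E r v)) x y"
    if xy: "x \<in> rel_ball E r v" "y \<in> rel_ball E r v" for x y
  proof -
    obtain m where "(x, y) \<in> parcs (ball_graph E r v) ^^ m"
      using ball_graph_relpow[OF assms(3) xy] by blast
    then obtain p where "awalk x p y" using relpow_imp_awalk xy(1) verts by blast
    then show ?thesis by (rule reachable_awalkI)
  qed
  show ?thesis
    unfolding Digraph_Component.connected_def
  proof (rule strongly_connectedI)
    show "verts (mk_symmetric (with_proj (ball_graph E r v))) \<noteq> {}"
      using centre_in_rel_ball[of v E r] verts by auto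
    fix x y
    assume "x \<in> verts (mk_symmetric (with_proj (ball_graph E r v)))"
      "y \<in> verts (mk_symmetric (with_proj (ball_graph E r v)))"
    then have "x \<in> rel_ball E r v" "y \<in> rel_ball E r v" using verts by auto
    then show "reachable (mk_symmetric (with_proj (ball_graph E r v))) x y"
      by (intro reachable_mk_symmetricI reach)
  qed
qed

text \<open>
  With \<open>n = (\<Sum>k\<le>2 * \<alpha>. 3 ^ k)\<close> one has \<open>2 * n < 3 ^ (2 * \<alpha> + 1)\<close>, so the left-hand side is at most
  \<open>9 ^ (2 * \<alpha> + 1)\<close>; the tower on the right is far larger.
\<close>

lemma radius_bound:
  fixes \<alpha> :: nat
  shows "2 * (\<Sum>k\<le>2 * \<alpha>. 3 ^ k) ^ 2 \<le> (9 ^ (3 ^ (2 ^ (\<alpha> ^ 12))) :: nat)"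
proof -
  have geometric: "2 * (\<Sum>k\<le>n. 3 ^ k) + 1 = (3 ^ Suc n :: nat)" for n
    by (induction n) simp_all
  have "\<alpha> \<le> \<alpha> ^ 12" by (cases "\<alpha> = 0") (simp_all add: self_le_power)
  also have "\<dots> \<le> 2 ^ (\<alpha> ^ 12)" by (rule less_imp_le) (rule less_exp)
  finally have "2 * \<alpha> + 1 \<le> 2 * 2 ^ (\<alpha> ^ 12) + 1" by simp
  also have "2 * n + 1 \<le> 3 ^ n" for n :: nat by (induction n) simp_all
  finally have exponent: "2 * \<alpha> + 1 \<le> 3 ^ (2 ^ (\<alpha> ^ 12))" .
  have "2 * (\<Sum>k\<le>2 * \<alpha>. 3 ^ k) ^ 2 \<le> (2 * (\<Sum>k\<le>2 * \<alpha>. 3 ^ k) :: nat) ^ 2"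
    by (simp add: power_mult_distrib)
  also have "\<dots> \<le> (3 ^ (2 * \<alpha> + 1)) ^ 2"
    using geometric[of "2 * \<alpha>"] by (intro power_mono) simp_all
  also have "\<dots> = 9 ^ (2 * \<alpha> + 1)" by (simp add: power_mult[symmetric] mult.commute[of _ 2]) (simp add: power_mult)
  also have "\<dots> \<le> 9 ^ (3 ^ (2 ^ (\<alpha> ^ 12)))" using exponent by (intro power_increasing) simp_all
  finally show ?thesis .
qed

theorem corollary1p7:
  fixes G :: "'a pair_pre_digraph" and c :: "'a set \<Rightarrow> nat"
  assumes "edge_coloured 3 G c"
  shows "\<exists>\<H> :: 'a pair_pre_digraph set.
           finite \<H> \<and> card \<H> \<le> 2 * independence_number G \<and>
           (\<forall>H \<in> \<H>. monochromatic_component G c H \<and>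
              diameter H \<le> ereal (9 ^ (3 ^ (2 ^ (independence_number G ^ 12))))) \<and>
           (\<Union>H \<in> \<H>. pverts H) = pverts G"
proof -
  interpret pair_graph G using assms by (simp add: edge_coloured_def)
  define \<alpha> where "\<alpha> = independence_number G"
  define r :: nat where "r = (\<Sum>k\<le>2 * \<alpha>. 3 ^ k) ^ 2"
  define E where "E i = {(u, v) \<in> parcs G. c {u, v} = i}" for i
  have symE: "sym (E i)" for i
    using arcs_symmetric by (auto simp: sym_def E_def insert_commute)
  have subE: "E i \<subseteq> pverts G \<times> pverts G" for i
    using in_arcsD1 in_arcsD2 by (auto simp: E_def)
  have irreflE: "irrefl (E i)" for i
    using no_loops' by (auto simp: irrefl_def E_def)
  have indep: "card M \<le> \<alpha>"
    if M: "M \<subseteq> pverts G" "\<And>i u v. i < 3 \<Longrightarrow> u \<in> M \<Longrightarrow> v \<in> M \<Longrightarrow> (u, v) \<in> E i \<Longrightarrow> u = v" for M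
  proof -
    have "(u, v) \<notin> parcs G" if "u \<in> M" "v \<in> M" for u v
    proof
      assume arc: "(u, v) \<in> parcs G"
      then have "c {u, v} < 3" using assms by (auto simp: edge_coloured_def)
      moreover have "(u, v) \<in> E (c {u, v})" using arc by (simp add: E_def)
      ultimately have "u = v" using M(2) that by blast
      then show False using no_loops'[OF arc] by simp
    qed
    then have "independent G M" using M(1) by (simp add: independent_def)
    moreover have "finite {S. independent G S}"
      by (rule finite_subset[of _ "Pow (pverts G)"]) (auto simp: independent_def pair_finite_verts)
    ultimately show ?thesis
      unfolding \<alpha>_def independence_number_def by (intro Max_ge) auto
  qed
  obtain \<B> where \<B>: "\<B> \<subseteq> {..<3} \<times> pverts G" "finite \<B>" "card \<B> \<le> 2 * \<alpha>"
    "pverts G \<subseteq> (\<Union>(i, v)\<in>\<B>. rel_ball (E i) r v)"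
    unfolding r_def by (rule ball_cover[of E "pverts G" \<alpha>]) (use symE indep in auto)
  define B where "B = (\<lambda>(i, v). ball_graph (E i) r v)"
  show ?thesis
  proof (intro exI[of _ "B ` \<B>"] conjI ballI)
    show "finite (B ` \<B>)" using \<B>(2) by simp
    show "card (B ` \<B>) \<le> 2 * independence_number G"
      using card_image_le[OF \<B>(2), of B] \<B>(3) by (simp add: \<alpha>_def)
    have verts: "pverts (B (i, v)) = rel_ball (E i) r v" for i v
      by (simp add: B_def ball_graph_def)
    have subset: "rel_ball (E i) r v \<subseteq> pverts G" if "(i, v) \<in> \<B>" for i v
      using rel_ball_subset[OF subE] \<B>(1) that by blast
    show "(\<Union>H\<in>B ` \<B>. pverts H) = pverts G"
    proof
      show "(\<Union>H\<in>B ` \<B>. pverts H) \<subseteq> pverts G" using subset verts by fastforce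
      show "pverts G \<subseteq> (\<Union>H\<in>B ` \<B>. pverts H)" using \<B>(4) verts by fastforce
    qed
    fix H assume "H \<in> B ` \<B>"
    then obtain i v where iv: "(i, v) \<in> \<B>" and H: "H = ball_graph (E i) r v" by (auto simp: B_def)
    have v: "v \<in> pverts G" using \<B>(1) iv by blast
    note ball = pair_finite_verts subE symE irreflE v
    have graph: "pair_graph H" unfolding H by (rule ball_graph_pair_graph[OF ball])
    then interpret H: pair_graph H .
    have "subgraph (with_proj H) (with_proj G)"
      using subset[OF iv] wf_digraph H.wf_digraph
      by (auto simp: subgraph_def compatible_def H ball_graph_def E_def)
    moreover have "Digraph_Component.connected (with_proj H)"
      unfolding H by (rule connected_ball_graph[OF ball])
    moreover have "\<forall>(u, v)\<in>parcs H. c {u, v} = i" by (auto simp: H ball_graph_def E_def)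
    ultimately show "monochromatic_component G c H"
      using graph unfolding monochromatic_component_def by blast
    have "diameter H \<le> ereal (real (2 * r))"
      unfolding H by (rule diameter_ball_graph_le[OF ball])
    also have "\<dots> \<le> ereal (real (9 ^ (3 ^ (2 ^ (\<alpha> ^ 12)))))"
      unfolding ereal_less_eq of_nat_le_iff r_def by (rule radius_bound)
    finally show "diameter H \<le> ereal (9 ^ (3 ^ (2 ^ (independence_number G ^ 12))))"
      by (simp add: \<alpha>_def)
  qed
qed

end
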